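(* Let $G$ be a graph on vertex set $\{1,\dots,n\}$, let $A\in\mathcal{S}(G)$, and let $\widehat G$ be a graph on vertex set $\{1,\dots,m\}$ ($m\ge n$) containing $G$ as a subgraph. If $A$ has the SSP (respectively, the SMP), then there exists $\widehat B\in\mathcal{S}(\widehat G)$ having the SSP (respectively, the SMP) such that $\operatorname{spec}(A)\subseteq\operatorname{spec}(\widehat B)$ (respectively, such that the ordered multiplicity list of $\widehat B$ is the ordered multiplicity list of $A$ augmented with $m-n$ entries equal to $1$). Furthermore, $q(\widehat G)\le m-n+q(A)$. If $A$ has the SSP, then $\widehat B$ can be chosen so that its spectrum (as a multiset) is $\operatorname{spec}(A)\cup\Lambda$, where $\Lambda$ is any set of $m-n$ distinct real numbers with $\operatorname{spec}(A)\cap\Lambda=\emptyset$.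
   Context: For a graph $G$ on $\{1,\dots,n\}$, $\mathcal{S}(G)$ is the set of real symmetric $n\times n$ matrices $A=(a_{ij})$ with $a_{ij}\ne0$ iff $ij\in E(G)$ for $i\ne j$. $q(A)$ is the number of distinct eigenvalues of $A$ and $q(G)=\min\{q(A):A\in\mathcal{S}(G)\}$. The ordered multiplicity list of a symmetric matrix with distinct eigenvalues $\lambda_1<\dots<\lambda_q$ of multiplicities $m_1,\dots,m_q$ is $(m_1,\dots,m_q)$. $\circ$ is the entrywise product. A real symmetric $n\times n$ matrix $A$ has the Strong Spectral Property (SSP) if the only real symmetric $X$ with $A\circ X=O$, $I\circ X=O$, $AX-XA=O$ is $X=O$; it has the Strong Multiplicity Property (SMP) if the only real symmetric $X$ with these three properties and $\operatorname{tr}(A^iX)=0$ for $i=0,\dots,n-1$ is $X=O$. *)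

theory Defs
  imports
    "Jordan_Normal_Form.Char_Poly"
    "Graph_Theory.Pair_Digraph"
    "Graph_Theory.Digraph_Component"
    "HOL-Library.Multiset"
begin

text \<open>
  A simple graph is a \<open>pair_graph\<close>: finite, loopless, with a symmetric set of arcs, so that
  the edge \<open>ij\<close> is the pair of arcs \<open>(i,j)\<close>, \<open>(j,i)\<close>.  Vertices are numbered from 0, to agree
  with matrix indices: the vertex set $\{1,\dots,n\}$ becomes \<open>{..<n}\<close>.
\<close>

definition graph_on :: "nat \<Rightarrow> nat pair_pre_digraph \<Rightarrow> bool" where
  "graph_on n G \<longleftrightarrow> pair_graph G \<and> pverts G = {..<n}"

definition symmetric_mat :: "nat \<Rightarrow> real mat \<Rightarrow> bool" where
  "symmetric_mat n A \<longleftrightarrow> A \<in> carrier_mat n n \<and> transpose_mat A = A"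

text \<open>The set $\mathcal{S}(G)$; diagonal entries are unrestricted.\<close>

definition graph_mats :: "nat pair_pre_digraph \<Rightarrow> real mat set" where
  "graph_mats G = {A. symmetric_mat (card (pverts G)) A \<and>
     (\<forall>i \<in> pverts G. \<forall>j \<in> pverts G. i \<noteq> j \<longrightarrow> (A $$ (i, j) \<noteq> 0 \<longleftrightarrow> (i, j) \<in> parcs G))}"

text \<open>
  The spectrum as a multiset.  Multiplicities are algebraic, which for real symmetric
  matrices are also the geometric ones.
\<close>

definition spec_mset :: "real mat \<Rightarrow> real multiset" where
  "spec_mset A = proots (char_poly A)"

definition num_distinct_eigenvalues :: "real mat \<Rightarrow> nat" where
  "num_distinct_eigenvalues A = card {x. eigenvalue A x}"

definition graph_q :: "nat pair_pre_digraph \<Rightarrow> nat" where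
  "graph_q G = (LEAST k. \<exists>A \<in> graph_mats G. num_distinct_eigenvalues A = k)"

definition ordered_multiplicity_list :: "real mat \<Rightarrow> nat list" where
  "ordered_multiplicity_list A =
     map (count (spec_mset A)) (sorted_list_of_set {x. eigenvalue A x})"

definition entrywise_prod :: "real mat \<Rightarrow> real mat \<Rightarrow> real mat" where
  "entrywise_prod A B = mat (dim_row A) (dim_col A) (\<lambda>ij. A $$ ij * B $$ ij)"

definition mat_trace :: "real mat \<Rightarrow> real" where
  "mat_trace A = (\<Sum>i<dim_row A. A $$ (i, i))"

text \<open>The following two notions are meant for symmetric (in particular square) \<open>A\<close> only.\<close>

definition SSP :: "real mat \<Rightarrow> bool" where
  "SSP A \<longleftrightarrow> (let n = dim_row A in
     \<forall>X. symmetric_mat n X \<and>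
         entrywise_prod A X = 0\<^sub>m n n \<and>
         entrywise_prod (1\<^sub>m n) X = 0\<^sub>m n n \<and>
         A * X - X * A = 0\<^sub>m n n
       \<longrightarrow> X = 0\<^sub>m n n)"

definition SMP :: "real mat \<Rightarrow> bool" where
  "SMP A \<longleftrightarrow> (let n = dim_row A in
     \<forall>X. symmetric_mat n X \<and>
         entrywise_prod A X = 0\<^sub>m n n \<and>
         entrywise_prod (1\<^sub>m n) X = 0\<^sub>m n n \<and>
         A * X - X * A = 0\<^sub>m n n \<and>
         (\<forall>i<n. mat_trace (A ^\<^sub>m i * X) = 0)
       \<longrightarrow> X = 0\<^sub>m n n)"

text \<open>
  A list \<open>us\<close> is \<open>ms\<close> augmented with \<open>k\<close> entries equal to 1 if it arises from \<open>ms\<close> by inserting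
  \<open>k\<close> ones at arbitrary positions, the entries of \<open>ms\<close> keeping their order.
\<close>

definition augmented_with_ones :: "nat list \<Rightarrow> nat \<Rightarrow> nat list \<Rightarrow> bool" where
  "augmented_with_ones ms k us \<longleftrightarrow> us \<in> shuffles ms (replicate k 1)"

end

theory Submission
  imports Defs "Jordan_Normal_Form.Schur_Decomposition"
begin

text \<open>
  Adjoin isolated vertices first: if \<open>D\<close> is diagonal with distinct entries outside the spectrum of
  \<open>A\<close>, then \<open>A \<oplus> D\<close> inherits the SSP (SMP).  The missing edges are then switched on with small
  weights \<open>s\<close>.  Parametrising orthogonal matrices by the Cayley transform of a skew matrix \<open>K\<close>, the
  requirement that \<open>A + W\<close> be orthogonally similar to \<open>A + f(A)\<close>, with \<open>f\<close> a polynomial (zero for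
  the SSP), becomes the polynomial equation
  \<open>(I + K) (A + W) (I - K) = (I - K) (A + f(A)) (I + K)\<close>.  Its linearisation in the free entries
  of \<open>W\<close>, in \<open>K\<close> and in \<open>f\<close> is onto the symmetric matrices precisely because of the SSP (SMP), so
  a contraction argument solves it for every small \<open>s\<close>.  The SSP and SMP are open conditions, and a small
  \<open>f\<close> keeps the order of the eigenvalues, whose multiplicities therefore survive.
\<close>

section \<open>Contractive systems of equations\<close>

text \<open>At \<open>A\<close> the matrices similar to \<open>A\<close> have the commutators of
  \<open>A\<close> with skew matrices as tangent directions, and the matrices patterned like
  \<open>A\<close> have themselves. A matrix \<open>X\<close> as in the SSP is exactly a symmetric
  matrix orthogonal to both kinds of directions, so the SSP says that the two families are
  transversal. For the SMP the eigenvalues may move as well, as long as equal ones move together;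
  this adds the powers of \<open>A\<close> as directions and the trace conditions on
  \<open>X\<close>. The Cayley form is chosen because, with denominators cleared, the equation is
  polynomial: what remains beyond its linear part is a sum of products of small quantities. A linear
  right inverse of the linear part turns the unknowns into one vector \<open>z\<close> and the
  equation into \<open>z = h z s\<close>, with \<open>h\<close> contracting near the origin. The
  pattern is controlled in two ways. On non-edges of \<open>A\<close> the entries of
  \<open>W\<close> are prescribed exactly as \<open>s\<close> or 0; on edges of \<open>A\<close>
  they are unknowns, and the entries of \<open>A + W\<close> stay nonzero only by closeness to
  \<open>A\<close>. Hence the perturbation is needed at every scale.\<close>

text \<open>The double orthogonal complement of a subspace, by Gaussian elimination on the
  coordinates: a coordinate on which \<open>V\<close> vanishes is dropped, any other is cleared with
  a pivot vector \<open>u\<close>.\<close>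

lemma subspace_hits_target:
  fixes V :: "('i \<Rightarrow> real) set" and w :: "'i \<Rightarrow> real"
  assumes "finite I" and "V \<noteq> {}"
    and "\<And>u v. u \<in> V \<Longrightarrow> v \<in> V \<Longrightarrow> (\<lambda>i. u i + v i) \<in> V"
    and "\<And>c v. v \<in> V \<Longrightarrow> (\<lambda>i. c * v i) \<in> V"
    and "\<And>x. (\<And>v. v \<in> V \<Longrightarrow> (\<Sum>i\<in>I. x i * v i) = 0) \<Longrightarrow> (\<Sum>i\<in>I. x i * w i) = 0"
  shows "\<exists>v\<in>V. \<forall>i\<in>I. v i = w i"
  using assms
proof (induction I arbitrary: V w rule: finite_induct)
  case empty
  then show ?case by auto
next
  case (insert a I)
  note add = insert.prems(2) and scale = insert.prems(3) and orth = insert.prems(4)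
  show ?case
  proof (cases "\<forall>v\<in>V. v a = 0")
    case True
    have single: "(\<Sum>i\<in>insert a I. (if i = a then 1 else 0) * f i) = f a" for f :: "'i \<Rightarrow> real"
      using insert.hyps by (simp add: if_distrib[of "\<lambda>c. c * _"] sum.delta cong: if_cong)
    have wa: "w a = 0"
      using orth[of "\<lambda>i. if i = a then 1 else 0"] True unfolding single by blast
    have "\<exists>v\<in>V. \<forall>i\<in>I. v i = w i"
    proof (rule insert.IH[OF insert.prems(1) add scale])
      fix x assume x: "\<And>v. v \<in> V \<Longrightarrow> (\<Sum>i\<in>I. x i * v i) = 0"
      have "(\<Sum>i\<in>insert a I. x i * w i) = 0"
        by (rule orth) (use True insert.hyps x in auto)
      then show "(\<Sum>i\<in>I. x i * w i) = 0" using wa insert.hyps by simp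
    qed auto
    then show ?thesis using True wa by auto
  next
    case False
    then obtain u where u: "u \<in> V" "u a \<noteq> 0" by auto
    define V' where "V' = {v \<in> V. v a = 0}"
    define c where "c = w a / u a"
    define w' where "w' = (\<lambda>i. w i - c * u i)"
    have w'a: "w' a = 0" using u by (simp add: w'_def c_def)
    have ne: "V' \<noteq> {}" using scale[OF u(1), of 0] by (auto simp: V'_def)
    have "\<exists>v\<in>V'. \<forall>i\<in>I. v i = w' i"
    proof (rule insert.IH[OF ne])
      fix x assume x: "\<And>v. v \<in> V' \<Longrightarrow> (\<Sum>i\<in>I. x i * v i) = 0"
      \<comment> \<open>The functional \<open>x\<close> is extended to the coordinate
        \<open>a\<close> so that it kills the pivot \<open>u\<close>; it then kills all of
        \<open>V\<close>, since every vector of \<open>V\<close> is a vector of \<open>V'\<close>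
        plus a multiple of \<open>u\<close>.\<close>
      define y where "y = x(a := - (\<Sum>i\<in>I. x i * u i) / u a)"
      have yI: "(\<Sum>i\<in>I. y i * f i) = (\<Sum>i\<in>I. x i * f i)" for f
        using insert.hyps by (intro sum.cong) (auto simp: y_def)
      have yu: "(\<Sum>i\<in>insert a I. y i * u i) = 0"
        using insert.hyps u by (simp add: yI) (simp add: y_def)
      have "(\<Sum>i\<in>insert a I. y i * w i) = 0"
      proof (rule orth)
        fix v assume v: "v \<in> V"
        have "(\<lambda>i. v i + (- (v a / u a)) * u i) \<in> V" by (rule add[OF v scale[OF u(1)]])
        then have v': "(\<lambda>i. v i + (- (v a / u a)) * u i) \<in> V'"
          using u by (simp add: V'_def)
        have "(\<Sum>i\<in>insert a I. y i * v i) = (\<Sum>i\<in>insert a I. y i * (v i + (- (v a / u a)) * u i))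
            + (v a / u a) * (\<Sum>i\<in>insert a I. y i * u i)"
          unfolding sum_distrib_left sum.distrib[symmetric]
          by (intro sum.cong) (auto simp: algebra_simps)
        also have "(\<Sum>i\<in>insert a I. y i * (v i + (- (v a / u a)) * u i)) = 0"
          using insert.hyps u x[OF v'] by (simp add: yI)
        finally show "(\<Sum>i\<in>insert a I. y i * v i) = 0" using yu by simp
      qed
      moreover have "(\<Sum>i\<in>insert a I. y i * w i)
          = (\<Sum>i\<in>insert a I. y i * w' i) + c * (\<Sum>i\<in>insert a I. y i * u i)"
        unfolding sum_distrib_left sum.distrib[symmetric]
        by (intro sum.cong) (auto simp: algebra_simps w'_def)
      ultimately have "(\<Sum>i\<in>insert a I. y i * w' i) = 0" using yu by simp
      then show "(\<Sum>i\<in>I. x i * w' i) = 0" using w'a insert.hyps by (simp add: yI)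
    qed (auto simp: V'_def add scale)
    then obtain v where v: "v \<in> V'" "\<forall>i\<in>I. v i = w' i" by auto
    have "(\<lambda>i. v i + c * u i) \<in> V" using v(1) u(1) by (intro add scale) (auto simp: V'_def)
    moreover have "v a + c * u a = w a" using v(1) u by (simp add: V'_def c_def)
    ultimately show ?thesis using v(2) by (intro bexI[of _ "\<lambda>i. v i + c * u i"]) (auto simp: w'_def)
  qed
qed

section \<open>Fixed points of contractions in finitely many coordinates\<close>

definition l1 :: "'i set \<Rightarrow> ('i \<Rightarrow> real) \<Rightarrow> real" where
  "l1 I x = (\<Sum>i\<in>I. \<bar>x i\<bar>)"

lemma l1_nonneg [simp]: "0 \<le> l1 I x"
  by (simp add: l1_def sum_nonneg)

lemma l1_zero [simp]: "l1 I (\<lambda>_. 0) = 0"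
  by (simp add: l1_def)

lemma l1_triangle: "l1 I (\<lambda>i. x i - z i) \<le> l1 I (\<lambda>i. x i - y i) + l1 I (\<lambda>i. y i - z i)"
  unfolding l1_def sum.distrib[symmetric] by (intro sum_mono) linarith

lemma abs_le_l1: "finite I \<Longrightarrow> i \<in> I \<Longrightarrow> \<bar>x i\<bar> \<le> l1 I x"
  unfolding l1_def by (rule member_le_sum) auto

text \<open>Banach's iteration from the origin. The rate 1/2 and a first step of length at most
  \<open>r / 2\<close> keep every iterate in the ball of radius \<open>r\<close>. As
  \<open>l1 I\<close> sees only the coordinates in \<open>I\<close>, limits are taken coordinatewise
  there, and the values outside \<open>I\<close> are arbitrary.\<close>

lemma l1_contraction_fixpoint:
  fixes \<Phi> :: "('i \<Rightarrow> real) \<Rightarrow> 'i \<Rightarrow> real"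
  assumes I: "finite I"
    and contr: "\<And>x y. l1 I x \<le> r \<Longrightarrow> l1 I y \<le> r \<Longrightarrow>
      l1 I (\<lambda>i. \<Phi> x i - \<Phi> y i) \<le> l1 I (\<lambda>i. x i - y i) / 2"
    and start: "l1 I (\<Phi> (\<lambda>_. 0)) \<le> r / 2"
  shows "\<exists>x. l1 I x \<le> r \<and> (\<forall>i\<in>I. x i = \<Phi> x i)"
proof -
  have r: "0 \<le> r" using start l1_nonneg[of I "\<Phi> (\<lambda>_. 0)"] by linarith
  define z where "z k = (\<Phi> ^^ k) (\<lambda>_. 0)" for k
  have z0: "z 0 = (\<lambda>_. 0)" and zS: "z (Suc k) = \<Phi> (z k)" for k by (simp_all add: z_def)
  have zr: "l1 I (z k) \<le> r" for k
  proof (induction k)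
    case (Suc k)
    have "l1 I (z (Suc k)) \<le> l1 I (\<lambda>i. \<Phi> (z k) i - \<Phi> (\<lambda>_. 0) i) + l1 I (\<Phi> (\<lambda>_. 0))"
      using l1_triangle[of I "\<Phi> (z k)" "\<lambda>_. 0" "\<Phi> (\<lambda>_. 0)"] by (simp add: zS)
    also have "\<dots> \<le> r / 2 + r / 2"
      using contr[OF Suc, of "\<lambda>_. 0"] Suc start r by auto
    finally show ?case by simp
  qed (simp add: z0 r)
  have step: "l1 I (\<lambda>i. z (Suc k) i - z k i) \<le> r * (1/2) ^ k" for k
  proof (induction k)
    case (Suc k)
    have "l1 I (\<lambda>i. z (Suc (Suc k)) i - z (Suc k) i) \<le> l1 I (\<lambda>i. z (Suc k) i - z k i) / 2"
      using contr[OF zr[of "Suc k"] zr[of k]] by (simp add: zS)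
    also have "\<dots> \<le> r * (1/2) ^ k / 2" using Suc by simp
    finally show ?case by simp
  qed (use zr[of 1] in \<open>simp add: z0\<close>)
  define x where "x i = lim (\<lambda>k. z k i)" for i
  have lim: "(\<lambda>k. z k i) \<longlonglongrightarrow> x i" if "i \<in> I" for i
  proof -
    have "summable (\<lambda>k. z (Suc k) i - z k i)"
    proof (rule summable_comparison_test')
      show "summable (\<lambda>k. r * (1/2 :: real) ^ k)" by (intro summable_mult summable_geometric) simp
      show "norm (z (Suc k) i - z k i) \<le> r * (1/2) ^ k" for k
        using order_trans[OF abs_le_l1[OF I that, of "\<lambda>i. z (Suc k) i - z k i"] step[of k]] by simp
    qed
    then have "convergent (\<lambda>k. z k i)" 
      using summable_LIMSEQ[of "\<lambda>k. z (Suc k) i - z k i"] sum_lessThan_telescope[of "\<lambda>k. z k i"]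
      by (auto simp: convergent_def z0)
    then show ?thesis unfolding x_def convergent_LIMSEQ_iff .
  qed
  have "(\<lambda>k. l1 I (z k)) \<longlonglongrightarrow> l1 I x"
    unfolding l1_def by (intro tendsto_intros lim)
  then have xr: "l1 I x \<le> r" by (rule LIMSEQ_le_const2) (use zr in auto)
  have "(\<lambda>k. l1 I (\<lambda>i. x i - z k i)) \<longlonglongrightarrow> l1 I (\<lambda>i. x i - x i)"
    unfolding l1_def by (intro tendsto_intros lim)
  then have a: "(\<lambda>k. l1 I (\<lambda>i. x i - z k i)) \<longlonglongrightarrow> 0" by simp
  have "(\<lambda>k. l1 I (\<lambda>i. z k i - x i)) \<longlonglongrightarrow> l1 I (\<lambda>i. x i - x i)"
    unfolding l1_def by (intro tendsto_intros lim)
  then have "(\<lambda>k. l1 I (\<lambda>i. z (Suc k) i - x i)) \<longlonglongrightarrow> 0"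
    using LIMSEQ_Suc[of "\<lambda>k. l1 I (\<lambda>i. z k i - x i)"] by simp
  then have "(\<lambda>k. l1 I (\<lambda>i. x i - z k i) / 2 + l1 I (\<lambda>i. z (Suc k) i - x i)) \<longlonglongrightarrow> 0 / 2 + 0"
    using a by (intro tendsto_intros) auto
  moreover have "l1 I (\<lambda>i. \<Phi> x i - x i) \<le> l1 I (\<lambda>i. x i - z k i) / 2 + l1 I (\<lambda>i. z (Suc k) i - x i)" for k
    using l1_triangle[of I "\<Phi> x" x "\<Phi> (z k)"] contr[OF xr zr[of k]] by (simp add: zS)
  ultimately have "l1 I (\<lambda>i. \<Phi> x i - x i) \<le> 0"
    by (intro LIMSEQ_le_const) auto
  then have "\<forall>i\<in>I. \<bar>\<Phi> x i - x i\<bar> \<le> 0"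
    using abs_le_l1[OF I, of _ "\<lambda>i. \<Phi> x i - x i"] by force
  then show ?thesis using xr by auto
qed

text \<open>
  Here \<open>s\<close> is a parameter.  The point of the two notions is that a product of two vanishing functions
  is contractive.
\<close>

definition vanishing :: "'i set \<Rightarrow> (('i \<Rightarrow> real) \<Rightarrow> real \<Rightarrow> real) \<Rightarrow> bool" where
  "vanishing I h \<longleftrightarrow> (\<exists>L\<ge>0. \<forall>z z' (s::real). l1 I z \<le> 1 \<longrightarrow> l1 I z' \<le> 1 \<longrightarrow> \<bar>s\<bar> \<le> 1 \<longrightarrow>
     \<bar>h z s\<bar> \<le> L * (l1 I z + \<bar>s\<bar>) \<and> \<bar>h z s - h z' s\<bar> \<le> L * l1 I (\<lambda>i. z i - z' i))"

definition contractive :: "'i set \<Rightarrow> (('i \<Rightarrow> real) \<Rightarrow> real \<Rightarrow> real) \<Rightarrow> bool" where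
  "contractive I h \<longleftrightarrow> (\<exists>L\<ge>0. \<forall>z z' (s::real). l1 I z \<le> 1 \<longrightarrow> l1 I z' \<le> 1 \<longrightarrow> \<bar>s\<bar> \<le> 1 \<longrightarrow>
     \<bar>h z s - h z' s\<bar> \<le> L * (l1 I z + l1 I z' + \<bar>s\<bar>) * l1 I (\<lambda>i. z i - z' i))"

section \<open>Sums and products of vanishing and contractive functions\<close>

lemma vanishing_linear:
  assumes "finite I"
  shows "vanishing I (\<lambda>z s. s * t + (\<Sum>i\<in>I. z i * c i))"
proof -
  define L where "L = \<bar>t\<bar> + (\<Sum>i\<in>I. \<bar>c i\<bar>)"
  have L: "\<bar>t\<bar> \<le> L" "0 \<le> L" by (auto simp: L_def sum_nonneg)
  have c: "\<bar>c i\<bar> \<le> L" if "i \<in> I" for i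
    using member_le_sum[of i I "\<lambda>i. \<bar>c i\<bar>"] assms that unfolding L_def by auto
  have lin: "\<bar>\<Sum>i\<in>I. z i * c i\<bar> \<le> L * l1 I z" for z
  proof -
    have "\<bar>\<Sum>i\<in>I. z i * c i\<bar> \<le> (\<Sum>i\<in>I. L * \<bar>z i\<bar>)"
      by (rule order_trans[OF sum_abs])
         (auto simp: abs_mult mult.commute[of L] intro!: sum_mono mult_left_mono c)
    then show ?thesis by (simp add: l1_def sum_distrib_left)
  qed
  have "\<bar>s * t + (\<Sum>i\<in>I. z i * c i)\<bar> \<le> L * (l1 I z + \<bar>s\<bar>)" for s z
  proof -
    have "\<bar>s * t\<bar> \<le> L * \<bar>s\<bar>"
      unfolding abs_mult by (subst mult.commute) (intro mult_right_mono L abs_ge_zero)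
    then show ?thesis using lin[of z] by (simp add: algebra_simps)
  qed
  moreover have "\<bar>s * t + (\<Sum>i\<in>I. z i * c i) - (s * t + (\<Sum>i\<in>I. z' i * c i))\<bar>
      \<le> L * l1 I (\<lambda>i. z i - z' i)" for s z z'
    using lin[of "\<lambda>i. z i - z' i"] by (simp add: algebra_simps sum_subtractf)
  ultimately show ?thesis using L unfolding vanishing_def by blast
qed

lemma vanishing_add:
  assumes "vanishing I f" "vanishing I g"
  shows "vanishing I (\<lambda>z s. f z s + g z s)"
proof -
  obtain L where L: "0 \<le> L"
    and f [rule_format]: "\<forall>z z' (s::real). l1 I z \<le> 1 \<longrightarrow> l1 I z' \<le> 1 \<longrightarrow> \<bar>s\<bar> \<le> 1 \<longrightarrow>
     \<bar>f z s\<bar> \<le> L * (l1 I z + \<bar>s\<bar>) \<and> \<bar>f z s - f z' s\<bar> \<le> L * l1 I (\<lambda>i. z i - z' i)"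
    using assms(1) unfolding vanishing_def by blast
  obtain M where M: "0 \<le> M"
    and g [rule_format]: "\<forall>z z' (s::real). l1 I z \<le> 1 \<longrightarrow> l1 I z' \<le> 1 \<longrightarrow> \<bar>s\<bar> \<le> 1 \<longrightarrow>
     \<bar>g z s\<bar> \<le> M * (l1 I z + \<bar>s\<bar>) \<and> \<bar>g z s - g z' s\<bar> \<le> M * l1 I (\<lambda>i. z i - z' i)"
    using assms(2) unfolding vanishing_def by blast
  show ?thesis unfolding vanishing_def
  proof (intro exI[of _ "L + M"] conjI allI impI)
    fix z z' and s :: real assume *: "l1 I z \<le> 1" "l1 I z' \<le> 1" "\<bar>s\<bar> \<le> 1"
    show "\<bar>f z s + g z s\<bar> \<le> (L + M) * (l1 I z + \<bar>s\<bar>)"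
      using f[OF *] g[OF *] unfolding distrib_right[of L M] by linarith
    show "\<bar>f z s + g z s - (f z' s + g z' s)\<bar> \<le> (L + M) * l1 I (\<lambda>i. z i - z' i)"
      using f[OF *] g[OF *] unfolding distrib_right[of L M] by linarith
  qed (use L M in auto)
qed

lemma contractive_add:
  assumes "contractive I f" "contractive I g"
  shows "contractive I (\<lambda>z s. f z s + g z s)"
proof -
  obtain L where L: "0 \<le> L"
    and f [rule_format]: "\<forall>z z' (s::real). l1 I z \<le> 1 \<longrightarrow> l1 I z' \<le> 1 \<longrightarrow> \<bar>s\<bar> \<le> 1 \<longrightarrow>
     \<bar>f z s - f z' s\<bar> \<le> L * (l1 I z + l1 I z' + \<bar>s\<bar>) * l1 I (\<lambda>i. z i - z' i)"
    using assms(1) unfolding contractive_def by blast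
  obtain M where M: "0 \<le> M"
    and g [rule_format]: "\<forall>z z' (s::real). l1 I z \<le> 1 \<longrightarrow> l1 I z' \<le> 1 \<longrightarrow> \<bar>s\<bar> \<le> 1 \<longrightarrow>
     \<bar>g z s - g z' s\<bar> \<le> M * (l1 I z + l1 I z' + \<bar>s\<bar>) * l1 I (\<lambda>i. z i - z' i)"
    using assms(2) unfolding contractive_def by blast
  show ?thesis unfolding contractive_def
  proof (intro exI[of _ "L + M"] conjI allI impI)
    fix z z' and s :: real assume *: "l1 I z \<le> 1" "l1 I z' \<le> 1" "\<bar>s\<bar> \<le> 1"
    show "\<bar>f z s + g z s - (f z' s + g z' s)\<bar>
        \<le> (L + M) * (l1 I z + l1 I z' + \<bar>s\<bar>) * l1 I (\<lambda>i. z i - z' i)"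
      using f[OF *] g[OF *] unfolding distrib_right[of L M] distrib_right[of "L * _"] by linarith
  qed (use L M in auto)
qed

lemma vanishing_uminus: "vanishing I f \<Longrightarrow> vanishing I (\<lambda>z s. - f z s)"
  unfolding vanishing_def by (simp add: abs_minus_commute)

lemma contractive_uminus: "contractive I f \<Longrightarrow> contractive I (\<lambda>z s. - f z s)"
  unfolding contractive_def by (simp add: abs_minus_commute)

lemma vanishing_diff: "vanishing I f \<Longrightarrow> vanishing I g \<Longrightarrow> vanishing I (\<lambda>z s. f z s - g z s)"
  using vanishing_add[OF _ vanishing_uminus, of I f g] by simp

lemma contractive_diff: "contractive I f \<Longrightarrow> contractive I g \<Longrightarrow> contractive I (\<lambda>z s. f z s - g z s)"
  using contractive_add[OF _ contractive_uminus, of I f g] by simp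

text \<open>A term in the parameter alone has no increment in \<open>z\<close>. This admits the
  first-order forcing term \<open>s * t\<close> of the similarity equation.\<close>

lemma contractive_param: "contractive I (\<lambda>z s. f s)"
  unfolding contractive_def by (intro exI[of _ 0]) auto

lemma vanishing_sum:
  "finite J \<Longrightarrow> (\<And>j. j \<in> J \<Longrightarrow> vanishing I (f j)) \<Longrightarrow> vanishing I (\<lambda>z s. \<Sum>j\<in>J. f j z s)"
proof (induction J rule: finite_induct)
  case empty
  show ?case unfolding vanishing_def by (intro exI[of _ 0]) auto
qed (simp add: vanishing_add)

lemma contractive_sum:
  "finite J \<Longrightarrow> (\<And>j. j \<in> J \<Longrightarrow> contractive I (f j)) \<Longrightarrow> contractive I (\<lambda>z s. \<Sum>j\<in>J. f j z s)"
  by (induction J rule: finite_induct) (simp_all add: contractive_param contractive_add)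

text \<open>In \<open>f * g - f' * g' = f * (g - g') + (f - f') * g'\<close> each summand is a small
  factor times a Lipschitz increment, so near the origin the Lipschitz constant of the product is
  itself small.\<close>

lemma vanishing_mult:
  assumes "vanishing I f" "vanishing I g"
  shows "vanishing I (\<lambda>z s. f z s * g z s)" "contractive I (\<lambda>z s. f z s * g z s)"
proof -
  obtain L where L: "0 \<le> L"
    and f [rule_format]: "\<forall>z z' (s::real). l1 I z \<le> 1 \<longrightarrow> l1 I z' \<le> 1 \<longrightarrow> \<bar>s\<bar> \<le> 1 \<longrightarrow>
     \<bar>f z s\<bar> \<le> L * (l1 I z + \<bar>s\<bar>) \<and> \<bar>f z s - f z' s\<bar> \<le> L * l1 I (\<lambda>i. z i - z' i)"
    using assms(1) unfolding vanishing_def by blast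
  obtain M where M: "0 \<le> M"
    and g [rule_format]: "\<forall>z z' (s::real). l1 I z \<le> 1 \<longrightarrow> l1 I z' \<le> 1 \<longrightarrow> \<bar>s\<bar> \<le> 1 \<longrightarrow>
     \<bar>g z s\<bar> \<le> M * (l1 I z + \<bar>s\<bar>) \<and> \<bar>g z s - g z' s\<bar> \<le> M * l1 I (\<lambda>i. z i - z' i)"
    using assms(2) unfolding vanishing_def by blast
  have key: "\<bar>f z s * g z s - f z' s * g z' s\<bar>
        \<le> L * M * (l1 I z + l1 I z' + 2 * \<bar>s\<bar>) * l1 I (\<lambda>i. z i - z' i)"
    if *: "l1 I z \<le> 1" "l1 I z' \<le> 1" "\<bar>s\<bar> \<le> 1" for z z' and s :: real
  proof -
    have "\<bar>f z s * g z s - f z' s * g z' s\<bar> = \<bar>f z s * (g z s - g z' s) + (f z s - f z' s) * g z' s\<bar>"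
      by (simp add: algebra_simps)
    also have "\<dots> \<le> \<bar>f z s\<bar> * \<bar>g z s - g z' s\<bar> + \<bar>f z s - f z' s\<bar> * \<bar>g z' s\<bar>"
      by (rule order_trans[OF abs_triangle_ineq]) (simp add: abs_mult)
    also have "\<dots> \<le> (L * (l1 I z + \<bar>s\<bar>)) * (M * l1 I (\<lambda>i. z i - z' i))
        + (L * l1 I (\<lambda>i. z i - z' i)) * (M * (l1 I z' + \<bar>s\<bar>))"
      using f[OF *] g[OF *] g[OF *(2,1,3)] L M by (intro add_mono mult_mono) auto
    finally show ?thesis by (simp add: algebra_simps)
  qed
  show "contractive I (\<lambda>z s. f z s * g z s)" unfolding contractive_def
  proof (intro exI[of _ "2 * (L * M)"] conjI allI impI)
    fix z z' and s :: real assume *: "l1 I z \<le> 1" "l1 I z' \<le> 1" "\<bar>s\<bar> \<le> 1"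
    have "L * M * (l1 I z + l1 I z' + 2 * \<bar>s\<bar>) \<le> L * M * (2 * (l1 I z + l1 I z' + \<bar>s\<bar>))"
      using L M by (intro mult_left_mono) auto
    then have "L * M * (l1 I z + l1 I z' + 2 * \<bar>s\<bar>) * l1 I (\<lambda>i. z i - z' i)
      \<le> L * M * (2 * (l1 I z + l1 I z' + \<bar>s\<bar>)) * l1 I (\<lambda>i. z i - z' i)"
      by (rule mult_right_mono) simp
    then show "\<bar>f z s * g z s - f z' s * g z' s\<bar>
        \<le> 2 * (L * M) * (l1 I z + l1 I z' + \<bar>s\<bar>) * l1 I (\<lambda>i. z i - z' i)"
      using key[OF *] by (simp add: mult_ac)
  qed (use L M in auto)
  show "vanishing I (\<lambda>z s. f z s * g z s)" unfolding vanishing_def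
  \<comment> \<open>All of \<open>l1 I z\<close>, \<open>l1 I z'\<close> and
    \<open>\<bar>s\<bar>\<close> are at most 1, so
    \<open>l1 I z + l1 I z' + 2 * \<bar>s\<bar>\<close> is at most 4.\<close>
  proof (intro exI[of _ "4 * (L * M)"] conjI allI impI)
    fix z z' and s :: real assume *: "l1 I z \<le> 1" "l1 I z' \<le> 1" "\<bar>s\<bar> \<le> 1"
    have "\<bar>f z s * g z s\<bar> \<le> (L * (l1 I z + \<bar>s\<bar>)) * (M * (l1 I z + \<bar>s\<bar>))"
      unfolding abs_mult using f[OF *] g[OF *] L M by (intro mult_mono) auto
    also have "\<dots> = L * M * ((l1 I z + \<bar>s\<bar>) * (l1 I z + \<bar>s\<bar>))" by (simp add: mult_ac)
    also have "\<dots> \<le> L * M * (4 * (l1 I z + \<bar>s\<bar>))"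
      using L M * by (intro mult_left_mono mult_right_mono) auto
    finally show "\<bar>f z s * g z s\<bar> \<le> 4 * (L * M) * (l1 I z + \<bar>s\<bar>)" by (simp add: mult_ac)
    have "L * M * (l1 I z + l1 I z' + 2 * \<bar>s\<bar>) \<le> L * M * 4"
      using L M * by (intro mult_left_mono) auto
    then have "L * M * (l1 I z + l1 I z' + 2 * \<bar>s\<bar>) * l1 I (\<lambda>i. z i - z' i)
      \<le> L * M * 4 * l1 I (\<lambda>i. z i - z' i)"
      by (rule mult_right_mono) simp
    then show "\<bar>f z s * g z s - f z' s * g z' s\<bar> \<le> 4 * (L * M) * l1 I (\<lambda>i. z i - z' i)"
      using key[OF *] by (simp add: mult_ac)
  qed (use L M in auto)
qed

lemma contractive_system_solvable:
  fixes h :: "'i \<Rightarrow> ('i \<Rightarrow> real) \<Rightarrow> real \<Rightarrow> real"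
  assumes I: "finite I"
    and van: "\<And>i. i \<in> I \<Longrightarrow> vanishing I (h i)"
    and con: "\<And>i. i \<in> I \<Longrightarrow> contractive I (h i)"
    and "0 < \<rho>"
  shows "\<exists>\<delta>>0. \<forall>s. \<bar>s\<bar> \<le> \<delta> \<longrightarrow> (\<exists>z. l1 I z \<le> \<rho> \<and> (\<forall>i\<in>I. z i = h i z s))"
proof -
  obtain L where "\<forall>i\<in>I. 0 \<le> L i \<and> (\<forall>z z' (s::real). l1 I z \<le> 1 \<longrightarrow> l1 I z' \<le> 1 \<longrightarrow> \<bar>s\<bar> \<le> 1 \<longrightarrow>
     \<bar>h i z s\<bar> \<le> L i * (l1 I z + \<bar>s\<bar>) \<and> \<bar>h i z s - h i z' s\<bar> \<le> L i * l1 I (\<lambda>i. z i - z' i))"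
    using van unfolding vanishing_def by atomize_elim (intro bchoice; auto)
  then have L: "\<And>i. i \<in> I \<Longrightarrow> 0 \<le> L i"
    "\<And>i z (s::real). i \<in> I \<Longrightarrow> l1 I z \<le> 1 \<Longrightarrow> \<bar>s\<bar> \<le> 1 \<Longrightarrow> \<bar>h i z s\<bar> \<le> L i * (l1 I z + \<bar>s\<bar>)"
    by force+
  obtain M where "\<forall>i\<in>I. 0 \<le> M i \<and> (\<forall>z z' (s::real). l1 I z \<le> 1 \<longrightarrow> l1 I z' \<le> 1 \<longrightarrow> \<bar>s\<bar> \<le> 1 \<longrightarrow>
     \<bar>h i z s - h i z' s\<bar> \<le> M i * (l1 I z + l1 I z' + \<bar>s\<bar>) * l1 I (\<lambda>i. z i - z' i))"
    using con unfolding contractive_def by atomize_elim (intro bchoice; auto)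
  then have M: "\<And>i. i \<in> I \<Longrightarrow> 0 \<le> M i"
    "\<And>i z z' (s::real). i \<in> I \<Longrightarrow> l1 I z \<le> 1 \<Longrightarrow> l1 I z' \<le> 1 \<Longrightarrow> \<bar>s\<bar> \<le> 1 \<Longrightarrow>
     \<bar>h i z s - h i z' s\<bar> \<le> M i * (l1 I z + l1 I z' + \<bar>s\<bar>) * l1 I (\<lambda>i. z i - z' i)"
    by simp_all
  define LL where "LL = sum L I"
  define MM where "MM = sum M I"
  have LL: "0 \<le> LL" and MM: "0 \<le> MM" by (auto simp: LL_def MM_def sum_nonneg L M)
  \<comment> \<open>In the ball, and for small \<open>s\<close>, the three lengths in the
    contraction estimate are at most \<open>r\<close>, and
    \<open>3 * r * (MM + 1) \<le> 1 / 2\<close> yields the rate 1/2. The \<open>+ 1\<close> keeps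
    the denominator positive.\<close>
  define r where "r = min \<rho> (min 1 (1 / (6 * (MM + 1))))"
  have r: "0 < r" "r \<le> \<rho>" "r \<le> 1" "r \<le> 1 / (6 * (MM + 1))"
    using \<open>0 < \<rho>\<close> MM by (simp_all add: r_def min.coboundedI1 min.coboundedI2 del: distrib_left_numeral)
  \<comment> \<open>At the origin the map has length at most \<open>LL * \<bar>s\<bar>\<close>,
    which must not exceed \<open>r / 2\<close>.\<close>
  define \<delta> where "\<delta> = min r (r / (2 * (LL + 1)))"
  have \<delta>: "0 < \<delta>" "\<delta> \<le> r" "\<delta> \<le> r / (2 * (LL + 1))"
    using r LL by (auto simp: \<delta>_def)
  have "\<exists>z. l1 I z \<le> \<rho> \<and> (\<forall>i\<in>I. z i = h i z s)" if s: "\<bar>s\<bar> \<le> \<delta>" for s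
  proof -
    have s1: "\<bar>s\<bar> \<le> 1" using s \<delta> r by linarith
    have "\<exists>z. l1 I z \<le> r \<and> (\<forall>i\<in>I. z i = h i z s)"
    proof (rule l1_contraction_fixpoint[OF I])
      fix x y assume xy: "l1 I x \<le> r" "l1 I y \<le> r"
      have xy1: "l1 I x \<le> 1" "l1 I y \<le> 1" using xy r by auto
      have "l1 I (\<lambda>i. h i x s - h i y s) \<le> (\<Sum>i\<in>I. M i * (l1 I x + l1 I y + \<bar>s\<bar>) * l1 I (\<lambda>i. x i - y i))"
        unfolding l1_def[of I "\<lambda>i. h i x s - h i y s"] by (intro sum_mono M xy1 s1)
      also have "\<dots> = MM * (l1 I x + l1 I y + \<bar>s\<bar>) * l1 I (\<lambda>i. x i - y i)"
        by (simp add: MM_def sum_distrib_right)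
      also have "\<dots> \<le> 1 / 2 * l1 I (\<lambda>i. x i - y i)"
      proof (rule mult_right_mono)
        have "MM * (l1 I x + l1 I y + \<bar>s\<bar>) \<le> (MM + 1) * (3 * (1 / (6 * (MM + 1))))"
          using xy s \<delta> r MM by (intro mult_mono) auto
        also have "\<dots> = 1 / 2" using MM by (simp add: field_simps)
        finally show "MM * (l1 I x + l1 I y + \<bar>s\<bar>) \<le> 1 / 2" .
      qed simp
      finally show "l1 I (\<lambda>i. h i x s - h i y s) \<le> l1 I (\<lambda>i. x i - y i) / 2" by simp
    next
      have "l1 I (\<lambda>i. h i (\<lambda>_. 0) s) \<le> (\<Sum>i\<in>I. L i * (l1 I (\<lambda>_. 0) + \<bar>s\<bar>))"
        unfolding l1_def[of I "\<lambda>i. h i (\<lambda>_. 0) s"] by (intro sum_mono L s1) auto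
      also have "\<dots> = LL * \<bar>s\<bar>" by (simp add: LL_def sum_distrib_right)
      also have "\<dots> \<le> (LL + 1) * (r / (2 * (LL + 1)))"
        using s \<delta> LL by (intro mult_mono) auto
      also have "\<dots> = r / 2" using LL by (simp add: field_simps)
      finally show "l1 I (\<lambda>i. h i (\<lambda>_. 0) s) \<le> r / 2" .
    qed
    then show ?thesis using r by force
  qed
  then show ?thesis using \<delta> by blast
qed

section \<open>The linearised similarity equation\<close>

text \<open>Carries smallness of \<open>z\<close> and \<open>s\<close> over to the entries of
  \<open>W\<close> and the coefficients of \<open>f\<close>, uniformly in the finitely many
  indices.\<close>

lemma vanishing_uniform:
  assumes "finite J" "\<And>j. j \<in> J \<Longrightarrow> vanishing I (h j)" "0 < \<rho>"
  shows "\<exists>\<delta>>0. \<forall>z s. l1 I z \<le> \<delta> \<longrightarrow> \<bar>s\<bar> \<le> \<delta> \<longrightarrow> (\<forall>j\<in>J. \<bar>h j z s\<bar> \<le> \<rho>)"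
  using assms(1,2)
proof (induction J rule: finite_induct)
  case empty
  then show ?case by (auto intro: exI[of _ 1])
next
  case (insert a J)
  obtain \<delta> where \<delta>: "\<delta> > 0" "\<forall>z s. l1 I z \<le> \<delta> \<longrightarrow> \<bar>s\<bar> \<le> \<delta> \<longrightarrow> (\<forall>j\<in>J. \<bar>h j z s\<bar> \<le> \<rho>)"
    using insert by auto
  obtain L where L: "0 \<le> L"
    and h [rule_format]: "\<forall>z z' s. l1 I z \<le> 1 \<longrightarrow> l1 I z' \<le> 1 \<longrightarrow> \<bar>s\<bar> \<le> 1 \<longrightarrow>
     \<bar>h a z s\<bar> \<le> L * (l1 I z + \<bar>s\<bar>) \<and> \<bar>h a z s - h a z' s\<bar> \<le> L * l1 I (\<lambda>i. z i - z' i)"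
    using insert.prems[of a] unfolding vanishing_def by blast
  define \<epsilon> where "\<epsilon> = min \<delta> (min 1 (\<rho> / (2 * (L + 1))))"
  have \<epsilon>: "0 < \<epsilon>" "\<epsilon> \<le> \<delta>" "\<epsilon> \<le> 1" "\<epsilon> \<le> \<rho> / (2 * (L + 1))"
    using \<delta> L assms(3)
    by (simp_all add: \<epsilon>_def min.coboundedI1 min.coboundedI2 del: distrib_left_numeral)
  have "\<bar>h a z s\<bar> \<le> \<rho>" if "l1 I z \<le> \<epsilon>" "\<bar>s\<bar> \<le> \<epsilon>" for z and s :: real
  proof -
    have "\<bar>h a z s\<bar> \<le> L * (l1 I z + \<bar>s\<bar>)" using h[of z z s] that \<epsilon> by auto
    also have "\<dots> \<le> (L + 1) * (2 * (\<rho> / (2 * (L + 1))))"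
      using that \<epsilon> L by (intro mult_mono) auto
    also have "\<dots> = \<rho>" using L by (simp add: field_simps)
    finally show ?thesis .
  qed
  then show ?case using \<delta> \<epsilon> by (intro exI[of _ \<epsilon>]) auto
qed

section \<open>Products of index functions; a common form of the SSP and the SMP\<close>

text \<open>Index functions can be added and scaled without dimension conditions. The unknowns are
  therefore treated as functions, and \<open>mat_mprod\<close> translates their products into
  products of matrices.\<close>

definition mprod :: "nat \<Rightarrow> (nat \<Rightarrow> nat \<Rightarrow> real) \<Rightarrow> (nat \<Rightarrow> nat \<Rightarrow> real) \<Rightarrow> nat \<Rightarrow> nat \<Rightarrow> real" where
  "mprod m a b i j = (\<Sum>k<m. a i k * b k j)"

lemma mat_mult_index: "A \<in> carrier_mat m n \<Longrightarrow> B \<in> carrier_mat n l \<Longrightarrow> i < m \<Longrightarrow> j < l \<Longrightarrow>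
    (A * B) $$ (i, j) = (\<Sum>k<n. A $$ (i, k) * B $$ (k, j))"
  by (auto simp: scalar_prod_def lessThan_atLeast0 intro!: sum.cong)

lemma mat_mprod: "mat m m (\<lambda>(i,j). f i j) * mat m m (\<lambda>(i,j). g i j) = mat m m (\<lambda>(i,j). mprod m f g i j)"
  by (rule eq_matI) (auto simp: mat_mult_index[where m=m and n=m and l=m] mprod_def simp del: index_mult_mat(1))

lemma vanishing_mprod:
  assumes "\<And>i j. i < m \<Longrightarrow> j < m \<Longrightarrow> vanishing I (\<lambda>z s. f z s i j)"
    and "\<And>i j. i < m \<Longrightarrow> j < m \<Longrightarrow> vanishing I (\<lambda>z s. g z s i j)"
    and "i < m" "j < m"
  shows "vanishing I (\<lambda>z s. mprod m (f z s) (g z s) i j)"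
    and "contractive I (\<lambda>z s. mprod m (f z s) (g z s) i j)"
  unfolding mprod_def
  by (intro vanishing_sum contractive_sum vanishing_mult; use assms in simp)+

text \<open>The Frobenius inner product: it turns the trace conditions of the SMP into orthogonality
  to the powers of \<open>A\<close>.\<close>

definition frob :: "nat \<Rightarrow> real mat \<Rightarrow> real mat \<Rightarrow> real" where
  "frob m A X = (\<Sum>i<m. \<Sum>j<m. A $$ (i, j) * X $$ (i, j))"

text \<open>The SSP is the case \<open>d = 0\<close>, the SMP the case \<open>d = m\<close>.\<close>

definition strong :: "nat \<Rightarrow> nat \<Rightarrow> real mat \<Rightarrow> bool" where
  "strong m d A \<longleftrightarrow> (\<forall>X. symmetric_mat m X \<longrightarrow>
     (\<forall>i<m. \<forall>j<m. A $$ (i, j) \<noteq> 0 \<or> i = j \<longrightarrow> X $$ (i, j) = 0) \<longrightarrow>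
     A * X = X * A \<longrightarrow> (\<forall>k<d. frob m (A ^\<^sub>m k) X = 0) \<longrightarrow> X = 0\<^sub>m m m)"

lemma symmetric_matD: "symmetric_mat m A \<Longrightarrow> i < m \<Longrightarrow> j < m \<Longrightarrow> A $$ (i, j) = A $$ (j, i)"
  unfolding symmetric_mat_def by (metis carrier_matD index_transpose_mat(1))

lemma symmetric_matI:
  "A \<in> carrier_mat m m \<Longrightarrow> (\<And>i j. i < m \<Longrightarrow> j < m \<Longrightarrow> A $$ (i, j) = A $$ (j, i)) \<Longrightarrow> symmetric_mat m A"
  unfolding symmetric_mat_def by (auto intro!: eq_matI)

lemma symmetric_mat_carrier: "symmetric_mat m A \<Longrightarrow> A \<in> carrier_mat m m"
  by (simp add: symmetric_mat_def)

lemma trace_mult_eq_frob: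
  assumes "A \<in> carrier_mat m m" "symmetric_mat m X"
  shows "mat_trace (A * X) = frob m A X"
proof -
  have X: "X \<in> carrier_mat m m" using assms by (simp add: symmetric_mat_def)
  have "mat_trace (A * X) = (\<Sum>i<m. \<Sum>k<m. A $$ (i, k) * X $$ (k, i))"
    unfolding mat_trace_def using assms(1) X
    by (auto simp: mat_mult_index[OF assms(1) X] simp del: index_mult_mat(1) intro!: sum.cong)
  also have "\<dots> = frob m A X"
    unfolding frob_def by (intro sum.cong refl) (auto simp: symmetric_matD[OF assms(2)])
  finally show ?thesis .
qed

lemma mat_diff_eq_0_iff:
  fixes A B :: "real mat"
  assumes "A \<in> carrier_mat m n" "B \<in> carrier_mat m n"
  shows "A - B = 0\<^sub>m m n \<longleftrightarrow> A = B"
proof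
  assume "A - B = 0\<^sub>m m n"
  then have "(A - B) $$ (i, j) = 0" if "i < m" "j < n" for i j using that by simp
  then show "A = B" using assms by (auto intro!: eq_matI)
qed (use assms in auto)

lemma entrywise_prod_eq_0_iff:
  assumes "A \<in> carrier_mat m m" 
  shows "entrywise_prod A X = 0\<^sub>m m m \<longleftrightarrow> (\<forall>i<m. \<forall>j<m. A $$ (i, j) \<noteq> 0 \<longrightarrow> X $$ (i, j) = 0)"
proof -
  have "entrywise_prod A X = 0\<^sub>m m m \<longleftrightarrow> (\<forall>i<m. \<forall>j<m. A $$ (i, j) * X $$ (i, j) = 0)"
    unfolding entrywise_prod_def using assms by (auto simp: mat_eq_iff)
  then show ?thesis by auto
qed

lemma strong_hypotheses_iff:
  assumes A: "A \<in> carrier_mat m m" and X: "symmetric_mat m X"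
  shows "entrywise_prod A X = 0\<^sub>m m m \<and> entrywise_prod (1\<^sub>m m) X = 0\<^sub>m m m \<longleftrightarrow>
      (\<forall>i<m. \<forall>j<m. A $$ (i, j) \<noteq> 0 \<or> i = j \<longrightarrow> X $$ (i, j) = 0)"
    and "A * X - X * A = 0\<^sub>m m m \<longleftrightarrow> A * X = X * A"
    and "mat_trace (A ^\<^sub>m k * X) = frob m (A ^\<^sub>m k) X"
proof -
  show "entrywise_prod A X = 0\<^sub>m m m \<and> entrywise_prod (1\<^sub>m m) X = 0\<^sub>m m m \<longleftrightarrow>
      (\<forall>i<m. \<forall>j<m. A $$ (i, j) \<noteq> 0 \<or> i = j \<longrightarrow> X $$ (i, j) = 0)"
    unfolding entrywise_prod_eq_0_iff[OF A] entrywise_prod_eq_0_iff[OF one_carrier_mat] by auto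
  show "A * X - X * A = 0\<^sub>m m m \<longleftrightarrow> A * X = X * A"
    using A symmetric_mat_carrier[OF X] by (intro mat_diff_eq_0_iff) auto
  show "mat_trace (A ^\<^sub>m k * X) = frob m (A ^\<^sub>m k) X"
    using A X by (intro trace_mult_eq_frob) auto
qed

lemma SSP_iff_strong: 
  assumes "A \<in> carrier_mat m m"
  shows "SSP A \<longleftrightarrow> strong m 0 A"
  unfolding SSP_def strong_def Let_def carrier_matD(1)[OF assms]
proof (intro iff_allI)
  fix X
  show "(symmetric_mat m X \<and> entrywise_prod A X = 0\<^sub>m m m \<and> entrywise_prod (1\<^sub>m m) X = 0\<^sub>m m m \<and>
      A * X - X * A = 0\<^sub>m m m \<longrightarrow> X = 0\<^sub>m m m) \<longleftrightarrow>
    (symmetric_mat m X \<longrightarrow> (\<forall>i<m. \<forall>j<m. A $$ (i, j) \<noteq> 0 \<or> i = j \<longrightarrow> X $$ (i, j) = 0) \<longrightarrow>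
      A * X = X * A \<longrightarrow> (\<forall>k<0. frob m (A ^\<^sub>m k) X = 0) \<longrightarrow> X = 0\<^sub>m m m)"
  proof (cases "symmetric_mat m X")
    case True
    show ?thesis
      unfolding strong_hypotheses_iff(1)[OF assms True, symmetric]
        strong_hypotheses_iff(2)[OF assms True, symmetric]
        strong_hypotheses_iff(3)[OF assms True, symmetric]
      by blast
  qed simp
qed

lemma SMP_iff_strong:
  assumes "A \<in> carrier_mat m m"
  shows "SMP A \<longleftrightarrow> strong m m A"
  unfolding SMP_def strong_def Let_def carrier_matD(1)[OF assms]
proof (intro iff_allI)
  fix X
  show "(symmetric_mat m X \<and> entrywise_prod A X = 0\<^sub>m m m \<and> entrywise_prod (1\<^sub>m m) X = 0\<^sub>m m m \<and>
      A * X - X * A = 0\<^sub>m m m \<and>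
      (\<forall>i<m. mat_trace (A ^\<^sub>m i * X) = 0) \<longrightarrow> X = 0\<^sub>m m m) \<longleftrightarrow>
    (symmetric_mat m X \<longrightarrow> (\<forall>i<m. \<forall>j<m. A $$ (i, j) \<noteq> 0 \<or> i = j \<longrightarrow> X $$ (i, j) = 0) \<longrightarrow>
      A * X = X * A \<longrightarrow> (\<forall>k<m. frob m (A ^\<^sub>m k) X = 0) \<longrightarrow> X = 0\<^sub>m m m)"
  proof (cases "symmetric_mat m X")
    case True
    show ?thesis
      unfolding strong_hypotheses_iff(1)[OF assms True, symmetric]
        strong_hypotheses_iff(2)[OF assms True, symmetric]
        strong_hypotheses_iff(3)[OF assms True, symmetric]
      by blast
  qed simp
qed

section \<open>Surjectivity of the linearisation\<close>

text \<open>For symmetric \<open>a\<close> the commutator map \<open>K \<mapsto> a K - K a\<close>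
  is self-adjoint for the entrywise inner product. Orthogonality to its values is thereby converted
  into a statement about the commutator of \<open>a\<close> and \<open>x\<close>.\<close>

lemma commutator_adjoint:
  fixes a x K :: "nat \<Rightarrow> nat \<Rightarrow> real"
  assumes "\<And>i j. i < m \<Longrightarrow> j < m \<Longrightarrow> a i j = a j i"
  shows "(\<Sum>i<m. \<Sum>j<m. x i j * (mprod m a K i j - mprod m K a i j))
    = (\<Sum>i<m. \<Sum>j<m. (mprod m a x i j - mprod m x a i j) * K i j)"
proof -
  have "(\<Sum>i<m. \<Sum>j<m. x i j * mprod m a K i j) = (\<Sum>i<m. \<Sum>j<m. \<Sum>k<m. x i j * (a i k * K k j))"
    by (simp add: mprod_def sum_distrib_left)
  also have "\<dots> = (\<Sum>i<m. \<Sum>k<m. \<Sum>j<m. x i j * (a i k * K k j))"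
    by (intro sum.cong refl sum.swap)
  also have "\<dots> = (\<Sum>k<m. \<Sum>i<m. \<Sum>j<m. x i j * (a i k * K k j))"
    by (rule sum.swap)
  also have "\<dots> = (\<Sum>k<m. \<Sum>j<m. \<Sum>i<m. x i j * (a i k * K k j))"
    by (intro sum.cong refl sum.swap)
  also have "\<dots> = (\<Sum>k<m. \<Sum>j<m. mprod m a x k j * K k j)"
    unfolding mprod_def sum_distrib_right
    by (intro sum.cong refl) (use assms in \<open>auto simp: mult_ac\<close>)
  finally have 1: "(\<Sum>i<m. \<Sum>j<m. x i j * mprod m a K i j) = (\<Sum>k<m. \<Sum>j<m. mprod m a x k j * K k j)" .
  have "(\<Sum>i<m. \<Sum>j<m. x i j * mprod m K a i j) = (\<Sum>i<m. \<Sum>j<m. \<Sum>k<m. x i j * (K i k * a k j))"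
    by (simp add: mprod_def sum_distrib_left)
  also have "\<dots> = (\<Sum>i<m. \<Sum>k<m. \<Sum>j<m. x i j * (K i k * a k j))"
    by (intro sum.cong refl sum.swap)
  also have "\<dots> = (\<Sum>i<m. \<Sum>k<m. mprod m x a i k * K i k)"
    unfolding mprod_def sum_distrib_right
    by (intro sum.cong refl) (use assms in \<open>auto simp: mult_ac\<close>)
  finally have 2: "(\<Sum>i<m. \<Sum>j<m. x i j * mprod m K a i j) = (\<Sum>i<m. \<Sum>j<m. mprod m x a i j * K i j)" .
  show ?thesis
    by (simp add: right_diff_distrib left_diff_distrib sum_subtractf 1 2)
qed

text \<open>
  Linearisation at the origin of the equation \<open>(I + K) (A + W) (I - K) = (I - K) (A + f(A)) (I + K)\<close>
  in the unknowns \<open>W\<close> (patterned like \<open>A\<close>), \<open>K\<close> (skew) and \<open>f\<close> (of degree below \<open>d\<close>).  Both sides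
  are symmetric, so a free skew term \<open>N\<close> makes the target the space of all matrices.
\<close>

definition linearised ::
    "nat \<Rightarrow> nat \<Rightarrow> real mat \<Rightarrow> (nat \<Rightarrow> nat \<Rightarrow> real) \<Rightarrow> (nat \<Rightarrow> nat \<Rightarrow> real) \<Rightarrow> (nat \<Rightarrow> real) \<Rightarrow>
      (nat \<Rightarrow> nat \<Rightarrow> real) \<Rightarrow> nat \<Rightarrow> nat \<Rightarrow> real" where
  "linearised m d A p K f N i j = p i j
     - 2 * (mprod m (\<lambda>i j. A $$ (i, j)) K i j - mprod m K (\<lambda>i j. A $$ (i, j)) i j)
     - (\<Sum>k<d. f k * (A ^\<^sub>m k) $$ (i, j)) + N i j"

definition admissible ::
    "nat \<Rightarrow> real mat \<Rightarrow> (nat \<Rightarrow> nat \<Rightarrow> real) \<Rightarrow> (nat \<Rightarrow> nat \<Rightarrow> real) \<Rightarrow> (nat \<Rightarrow> nat \<Rightarrow> real) \<Rightarrow> bool" where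
  "admissible m A p K N \<longleftrightarrow> (\<forall>i<m. \<forall>j<m. p i j = p j i \<and> K i j = - K j i \<and> N i j = - N j i \<and>
     (i \<noteq> j \<and> A $$ (i, j) = 0 \<longrightarrow> p i j = 0))"

lemma linearised_sum:
  "linearised m d A (\<lambda>i j. \<Sum>q\<in>Q. c q * p q i j) (\<lambda>i j. \<Sum>q\<in>Q. c q * K q i j)
     (\<lambda>k. \<Sum>q\<in>Q. c q * f q k) (\<lambda>i j. \<Sum>q\<in>Q. c q * N q i j) i j
   = (\<Sum>q\<in>Q. c q * linearised m d A (p q) (K q) (f q) (N q) i j)"
proof -
  have 1: "mprod m a (\<lambda>i j. \<Sum>q\<in>Q. c q * K q i j) i j = (\<Sum>q\<in>Q. c q * mprod m a (K q) i j)" for a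
    unfolding mprod_def sum_distrib_left by (subst sum.swap) (simp add: mult_ac)
  have 2: "mprod m (\<lambda>i j. \<Sum>q\<in>Q. c q * K q i j) a i j = (\<Sum>q\<in>Q. c q * mprod m (K q) a i j)" for a
    unfolding mprod_def sum_distrib_left sum_distrib_right by (subst sum.swap) (simp add: mult_ac)
  have 3: "(\<Sum>k<d. (\<Sum>q\<in>Q. c q * f q k) * (A ^\<^sub>m k) $$ (i, j))
      = (\<Sum>q\<in>Q. c q * (\<Sum>k<d. f q k * (A ^\<^sub>m k) $$ (i, j)))"
    unfolding sum_distrib_left sum_distrib_right by (subst sum.swap) (simp add: mult_ac)
  have 4: "c * (u - 2 * (v - w) - x + y) = c * u - 2 * (c * v - c * w) - c * x + c * y"
    for c u v w x y :: real by (simp add: algebra_simps)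
  show ?thesis
    unfolding linearised_def 1 2 3 4
    by (simp add: sum.distrib sum_subtractf sum_distrib_left[symmetric])
qed

lemma admissible_sum:
  assumes "\<And>q. q \<in> Q \<Longrightarrow> admissible m A (p q) (K q) (N q)"
  shows "admissible m A (\<lambda>i j. \<Sum>q\<in>Q. c q * p q i j) (\<lambda>i j. \<Sum>q\<in>Q. c q * K q i j)
    (\<lambda>i j. \<Sum>q\<in>Q. c q * N q i j)"
  unfolding admissible_def
proof (intro allI impI conjI)
  fix i j assume ij: "i < m" "j < m"
  note * = assms[unfolded admissible_def, rule_format, OF _ ij]
  show "(\<Sum>q\<in>Q. c q * p q i j) = (\<Sum>q\<in>Q. c q * p q j i)"
    using * by (intro sum.cong refl) simp
  have "K q i j = - K q j i" if "q \<in> Q" for q using *[OF that] by blast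
  then show "(\<Sum>q\<in>Q. c q * K q i j) = - (\<Sum>q\<in>Q. c q * K q j i)"
    by (simp add: sum_negf)
  have "N q i j = - N q j i" if "q \<in> Q" for q using *[OF that] by blast
  then show "(\<Sum>q\<in>Q. c q * N q i j) = - (\<Sum>q\<in>Q. c q * N q j i)"
    by (simp add: sum_negf)
  show "(\<Sum>q\<in>Q. c q * p q i j) = 0" if "i \<noteq> j \<and> A $$ (i, j) = 0"
  proof (intro sum.neutral ballI)
    fix q assume "q \<in> Q"
    from *[OF this] that show "c q * p q i j = 0" by simp
  qed
qed

lemma admissible_add:
  assumes "admissible m A p K N" "admissible m A p' K' N'"
  shows "admissible m A (\<lambda>i j. p i j + p' i j) (\<lambda>i j. K i j + K' i j) (\<lambda>i j. N i j + N' i j)"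
  unfolding admissible_def
proof (intro allI impI)
  fix i j assume ij: "i < m" "j < m"
  from assms[unfolded admissible_def, rule_format, OF ij]
  show "p i j + p' i j = p j i + p' j i \<and> K i j + K' i j = - (K j i + K' j i) \<and>
      N i j + N' i j = - (N j i + N' j i) \<and> (i \<noteq> j \<and> A $$ (i, j) = 0 \<longrightarrow> p i j + p' i j = 0)"
    by linarith
qed

lemma admissible_scale:
  assumes "admissible m A p K N"
  shows "admissible m A (\<lambda>i j. c * p i j) (\<lambda>i j. c * K i j) (\<lambda>i j. c * N i j)"
  using admissible_sum[of "UNIV :: unit set" m A "\<lambda>_. p" "\<lambda>_. K" "\<lambda>_. N" "\<lambda>_. c"] assms by simp

lemma sum_sum_sq_eq_0D:
  fixes f :: "nat \<Rightarrow> nat \<Rightarrow> real"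
  assumes "(\<Sum>i<m. \<Sum>j<m. f i j * f i j) = 0" "i < m" "j < m"
  shows "f i j = 0"
  using assms by (auto simp: sum_nonneg_eq_0_iff sum_nonneg)

text \<open>By duality it suffices that a matrix \<open>x\<close> orthogonal to the range vanishes.
  Testing it against the directions \<open>N\<close>, \<open>p\<close>, \<open>K\<close> and
  \<open>f\<close> in turn makes it symmetric, zero on the pattern and the diagonal, commuting with
  \<open>A\<close>, and orthogonal to the powers of \<open>A\<close>; these are the hypotheses in
  \<open>strong\<close>. Each test direction but the last is built from \<open>x\<close> so that the
  pairing becomes a sum of squares.\<close>

lemma linearised_surj:
  fixes w :: "nat \<times> nat \<Rightarrow> real"
  assumes A: "symmetric_mat m A" and st: "strong m d A"
  shows "\<exists>p K f N. admissible m A p K N \<and>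
    (\<forall>i<m. \<forall>j<m. linearised m d A p K f N i j = w (i, j))"
proof -
  let ?I = "{..<m} \<times> {..<m}"
  define V where "V = {v :: nat \<times> nat \<Rightarrow> real. \<exists>p K f N. admissible m A p K N \<and>
    (\<forall>i<m. \<forall>j<m. linearised m d A p K f N i j = v (i, j))}"
  have "\<exists>v\<in>V. \<forall>q\<in>?I. v q = w q"
  proof (rule subspace_hits_target)
    have "(\<lambda>q. linearised m d A (\<lambda>_ _. 0) (\<lambda>_ _. 0) (\<lambda>_. 0) (\<lambda>_ _. 0) (fst q) (snd q)) \<in> V"
      unfolding V_def by (intro CollectI exI conjI allI impI refl)
        (auto simp: admissible_def)
    then show "V \<noteq> {}" by auto
  next
    fix u v assume "u \<in> V" "v \<in> V"
    then obtain p K f N p' K' f' N' where *: "admissible m A p K N" "admissible m A p' K' N'"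
      "\<forall>i<m. \<forall>j<m. linearised m d A p K f N i j = u (i, j)"
      "\<forall>i<m. \<forall>j<m. linearised m d A p' K' f' N' i j = v (i, j)"
      unfolding V_def by blast
    have "linearised m d A (\<lambda>i j. p i j + p' i j) (\<lambda>i j. K i j + K' i j) (\<lambda>k. f k + f' k)
        (\<lambda>i j. N i j + N' i j) i j = u (i, j) + v (i, j)" if "i < m" "j < m" for i j
      using *(3,4) that
        linearised_sum[of m d A "\<lambda>_. 1" "\<lambda>b. if b then p else p'" UNIV
          "\<lambda>b. if b then K else K'" "\<lambda>b. if b then f else f'" "\<lambda>b. if b then N else N'" i j]
      by (simp add: UNIV_bool add.commute)
    then show "(\<lambda>i. u i + v i) \<in> V"
      unfolding V_def using admissible_add[OF *(1,2)] by blast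
  next
    fix c v assume "v \<in> V"
    then obtain p K f N where *: "admissible m A p K N"
      "\<forall>i<m. \<forall>j<m. linearised m d A p K f N i j = v (i, j)"
      unfolding V_def by blast
    have "linearised m d A (\<lambda>i j. c * p i j) (\<lambda>i j. c * K i j) (\<lambda>k. c * f k) (\<lambda>i j. c * N i j) i j
        = c * v (i, j)" if "i < m" "j < m" for i j
      using *(2) that
        linearised_sum[of m d A "\<lambda>_. c" "\<lambda>_. p" "UNIV :: unit set" "\<lambda>_. K" "\<lambda>_. f" "\<lambda>_. N" i j]
      by simp
    then show "(\<lambda>i. c * v i) \<in> V"
      unfolding V_def using admissible_scale[OF *(1)] by blast
  next
    fix x assume x: "\<And>v. v \<in> V \<Longrightarrow> (\<Sum>q\<in>?I. x q * v q) = 0"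
    have orth: "(\<Sum>i<m. \<Sum>j<m. x (i, j) * linearised m d A p K f N i j) = 0"
      if "admissible m A p K N" for p K f N
    proof -
      have "(\<lambda>q. linearised m d A p K f N (fst q) (snd q)) \<in> V"
        unfolding V_def using that by auto
      from x[OF this] show ?thesis by (simp add: sum.cartesian_product split_def)
    qed
    define a where "a i j = A $$ (i, j)" for i j
    have a: "a i j = a j i" if "i < m" "j < m" for i j
      using symmetric_matD[OF A that] by (simp add: a_def)
    let ?z = "\<lambda>_ _. 0 :: real"
    have mz: "mprod m b ?z i j = 0" "mprod m ?z b i j = 0" for b i j by (simp_all add: mprod_def)
    have sym: "x (i, j) = x (j, i)" if ij: "i < m" "j < m" for i j
    proof -
      have "admissible m A ?z ?z (\<lambda>i j. x (i, j) - x (j, i))" by (simp add: admissible_def)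
      from orth[OF this, of "\<lambda>_. 0"]
      have 1: "(\<Sum>i<m. \<Sum>j<m. x (i, j) * (x (i, j) - x (j, i))) = 0"
        by (simp add: linearised_def mz)
      then have 2: "(\<Sum>i<m. \<Sum>j<m. x (j, i) * (x (j, i) - x (i, j))) = 0"
        by (subst sum.swap) simp
      have "(\<Sum>i<m. \<Sum>j<m. (x (i, j) - x (j, i)) * (x (i, j) - x (j, i)))
          = (\<Sum>i<m. \<Sum>j<m. x (i, j) * (x (i, j) - x (j, i)))
            + (\<Sum>i<m. \<Sum>j<m. x (j, i) * (x (j, i) - x (i, j)))"
        unfolding sum.distrib[symmetric] by (intro sum.cong refl) (simp add: algebra_simps)
      then have "(\<Sum>i<m. \<Sum>j<m. (x (i, j) - x (j, i)) * (x (i, j) - x (j, i))) = 0"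
        using 1 2 by simp
      from sum_sum_sq_eq_0D[OF this ij] show ?thesis by simp
    qed
    have supp: "x (i, j) = 0" if ij: "i < m" "j < m" and nz: "A $$ (i, j) \<noteq> 0 \<or> i = j" for i j
    proof -
      define p where "p i j = (if A $$ (i, j) \<noteq> 0 \<or> i = j then x (i, j) else 0)" for i j
      have "admissible m A p ?z ?z"
        unfolding admissible_def p_def by (auto simp: sym symmetric_matD[OF A])
      from orth[OF this, of "\<lambda>_. 0"] have "(\<Sum>i<m. \<Sum>j<m. x (i, j) * p i j) = 0"
        by (simp add: linearised_def mz)
      also have "(\<Sum>i<m. \<Sum>j<m. x (i, j) * p i j) = (\<Sum>i<m. \<Sum>j<m. p i j * p i j)"
        by (intro sum.cong refl) (simp add: p_def)
      finally show ?thesis using sum_sum_sq_eq_0D[where m = m and f = p and i = i and j = j] ij nz by (simp add: p_def)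
    qed
    have comm: "mprod m a (\<lambda>i j. x (i, j)) i j = mprod m (\<lambda>i j. x (i, j)) a i j"
      if ij: "i < m" "j < m" for i j
    proof -
      \<comment> \<open>The commutator of \<open>A\<close> and \<open>x\<close> is skew, since both
        are symmetric, and hence an allowed direction; by self-adjointness the pairing is then a
        multiple of its own squared norm.\<close>
      define K where "K i j = mprod m a (\<lambda>i j. x (i, j)) i j - mprod m (\<lambda>i j. x (i, j)) a i j" for i j
      have Ksk: "K i j = - K j i" if "i < m" "j < m" for i j
      proof -
        have "mprod m a (\<lambda>i j. x (i, j)) i j = mprod m (\<lambda>i j. x (i, j)) a j i"
          unfolding mprod_def by (intro sum.cong refl) (use that a sym in auto)
        moreover have "mprod m a (\<lambda>i j. x (i, j)) j i = mprod m (\<lambda>i j. x (i, j)) a i j"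
          unfolding mprod_def by (intro sum.cong refl) (use that a sym in auto)
        ultimately show ?thesis by (simp add: K_def)
      qed
      have "admissible m A ?z K ?z"
        unfolding admissible_def minus_zero by (intro allI impI conjI refl Ksk)
      note orth[OF this, of "\<lambda>_. 0"]
      moreover have "linearised m d A ?z K (\<lambda>_. 0) ?z i j = - (2 * (mprod m a K i j - mprod m K a i j))" for i j
        by (simp add: linearised_def a_def[symmetric, abs_def])
      ultimately have "(\<Sum>i<m. \<Sum>j<m. x (i, j) * (2 * (mprod m a K i j - mprod m K a i j))) = 0"
        by (simp only: mult_minus_right sum_negf neg_equal_0_iff_equal)
      also have "(\<Sum>i<m. \<Sum>j<m. x (i, j) * (2 * (mprod m a K i j - mprod m K a i j)))
          = 2 * (\<Sum>i<m. \<Sum>j<m. x (i, j) * (mprod m a K i j - mprod m K a i j))"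
        by (simp only: sum_distrib_left mult.left_commute)
      also have "\<dots> = 2 * (\<Sum>i<m. \<Sum>j<m. K i j * K i j)"
        using commutator_adjoint[where m = m and a = a and x = "\<lambda>i j. x (i, j)" and K = K] a by (simp add: K_def)
      finally have "(\<Sum>i<m. \<Sum>j<m. K i j * K i j) = 0" by simp
      from sum_sum_sq_eq_0D[OF this ij] show ?thesis by (simp add: K_def)
    qed
    have pow: "(\<Sum>i<m. \<Sum>j<m. x (i, j) * (A ^\<^sub>m k) $$ (i, j)) = 0" if k: "k < d" for k
    proof -
      have "admissible m A ?z ?z ?z" by (simp add: admissible_def)
      from orth[OF this, of "\<lambda>l. if l = k then 1 else 0"] k show ?thesis
        by (simp add: linearised_def mz sum_negf if_distrib[of "\<lambda>c. c * _"] sum.delta' cong: if_cong)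
    qed
    define X where "X = mat m m x"
    have X: "X \<in> carrier_mat m m" by (simp add: X_def)
    have Aa: "A = mat m m (\<lambda>(i,j). a i j)"
      using symmetric_mat_carrier[OF A] by (auto simp: a_def intro!: eq_matI)
    have Xx: "X = mat m m (\<lambda>(i,j). x (i, j))" by (auto simp: X_def)
    have "X = 0\<^sub>m m m"
    proof (rule st[unfolded strong_def, rule_format])
      show "symmetric_mat m X" by (rule symmetric_matI[OF X]) (simp add: X_def sym)
      show "A * X = X * A"
        unfolding Aa Xx mat_mprod by (rule eq_matI) (simp_all add: comm)
      show "frob m (A ^\<^sub>m k) X = 0" if "k < d" for k
        using pow[OF that] by (simp add: frob_def X_def mult.commute)
    qed (simp add: X_def supp)
    then have "x (i, j) = 0" if "i < m" "j < m" for i j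
      using that by (metis X_def index_mat(1) index_zero_mat(1))
    then show "(\<Sum>q\<in>?I. x q * w q) = 0" by (intro sum.neutral) auto
  qed simp
  then obtain v where v: "v \<in> V" "\<And>i j. i < m \<Longrightarrow> j < m \<Longrightarrow> v (i, j) = w (i, j)" by auto
  then obtain p K f N where "admissible m A p K N"
    "\<And>i j. i < m \<Longrightarrow> j < m \<Longrightarrow> linearised m d A p K f N i j = v (i, j)"
    unfolding V_def by blast
  then show ?thesis using v(2) by (intro exI[of _ p] exI[of _ K] exI[of _ f] exI[of _ N]) simp
qed

text \<open>One preimage is fixed for each matrix unit; linear combinations of these give preimages
  that depend linearly on the target.\<close>

lemma linearised_right_inverse:
  assumes "symmetric_mat m A" and "strong m d A"
  obtains p K f N where "\<And>q. admissible m A (p q) (K q) (N q)"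
    "\<And>q i j. i < m \<Longrightarrow> j < m \<Longrightarrow>
       linearised m d A (p q) (K q) (f q) (N q) i j = (if (i, j) = q then 1 else 0)"
proof -
  define sol where "sol q r \<longleftrightarrow> admissible m A (fst r) (fst (snd r)) (snd (snd (snd r))) \<and>
    (\<forall>i<m. \<forall>j<m. linearised m d A (fst r) (fst (snd r)) (fst (snd (snd r))) (snd (snd (snd r))) i j
        = (if (i, j) = q then 1 else 0))" for q :: "nat \<times> nat" and r
  have "\<exists>r. sol q r" for q
  proof -
    obtain p K f N where "admissible m A p K N"
      "\<forall>i<m. \<forall>j<m. linearised m d A p K f N i j = (if (i, j) = q then 1 else 0)"
      using linearised_surj[OF assms, of "\<lambda>ij. if ij = q then 1 else 0"] by blast
    then show "\<exists>r. sol q r" unfolding sol_def by (intro exI[of _ "(p, K, f, N)"]) auto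
  qed
  then obtain R where R: "\<And>q. sol q (R q)" by metis
  show thesis
    by (rule that[of "\<lambda>q. fst (R q)" "\<lambda>q. fst (snd (R q))" "\<lambda>q. snd (snd (snd (R q)))" "\<lambda>q. fst (snd (snd (R q)))"])
      (use R in \<open>auto simp: sol_def\<close>)
qed

section \<open>Solving the similarity equation\<close>

lemma mprod_add_left: "mprod m (\<lambda>i j. a i j + b i j) c i j = mprod m a c i j + mprod m b c i j"
  and mprod_add_right: "mprod m c (\<lambda>i j. a i j + b i j) i j = mprod m c a i j + mprod m c b i j"
  and mprod_diff_left: "mprod m (\<lambda>i j. a i j - b i j) c i j = mprod m a c i j - mprod m b c i j"
  and mprod_diff_right: "mprod m c (\<lambda>i j. a i j - b i j) i j = mprod m c a i j - mprod m c b i j"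
  by (simp_all add: mprod_def algebra_simps sum.distrib sum_subtractf)

lemma mprod_assoc: "mprod m (mprod m a b) c i j = mprod m a (mprod m b c) i j"
  unfolding mprod_def sum_distrib_left sum_distrib_right by (subst sum.swap) (simp add: mult_ac)

lemma mprod_sym_skew:
  assumes "\<And>i j. i < m \<Longrightarrow> j < m \<Longrightarrow> w i j = w j i" "\<And>i j. i < m \<Longrightarrow> j < m \<Longrightarrow> K i j = - K j i"
    and "i < m" "j < m"
  shows "mprod m w K j i = - mprod m K w i j"
  unfolding mprod_def sum_negf[symmetric]
proof (intro sum.cong refl)
  fix k assume "k \<in> {..<m}"
  then show "w j k * K k i = - (K i k * w k j)"
    using assms(1)[of j k] assms(2)[of k i] assms(3,4) by simp
qed

text \<open>Transposing \<open>K w K\<close> changes the sign twice. Together with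
  \<open>mprod_sym_skew\<close> this makes the nonlinear remainder of the equation
  symmetric.\<close>

lemma mprod_skew_sym_skew:
  assumes "\<And>i j. i < m \<Longrightarrow> j < m \<Longrightarrow> w i j = w j i" "\<And>i j. i < m \<Longrightarrow> j < m \<Longrightarrow> K i j = - K j i"
    and "i < m" "j < m"
  shows "mprod m K (mprod m w K) j i = mprod m K (mprod m w K) i j"
proof -
  have "mprod m K (mprod m w K) j i = mprod m (mprod m K w) K i j"
    unfolding mprod_def[of m K "mprod m w K"] mprod_def[of m "mprod m K w" K]
  proof (intro sum.cong refl)
    fix k assume "k \<in> {..<m}"
    then have k: "k < m" by simp
    have "mprod m w K k i = - mprod m K w i k"
      by (rule mprod_sym_skew[OF assms(1,2) assms(3) k])
    moreover have "K j k = - K k j" by (rule assms(2)[OF assms(4) k])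
    ultimately show "K j k * mprod m w K k i = mprod m K w i k * K k j" by simp
  qed
  then show ?thesis by (simp add: mprod_assoc)
qed

text \<open>The term \<open>K Y K\<close> has the same sign in both expansions. When the two sides
  of the equation are compared, \<open>A\<close> therefore cancels from it and only
  \<open>K (W - F) K\<close> is left.\<close>

lemma cayley_expand:
  fixes K Y :: "real mat"
  assumes K: "K \<in> carrier_mat m m" and Y: "Y \<in> carrier_mat m m"
  shows "(1\<^sub>m m + K) * Y * (1\<^sub>m m - K) = Y + K * Y - Y * K - K * (Y * K)"
    and "(1\<^sub>m m - K) * Y * (1\<^sub>m m + K) = Y - K * Y + Y * K - K * (Y * K)"
proof -
  have KY: "K * Y \<in> carrier_mat m m" "Y * K \<in> carrier_mat m m" "K * (Y * K) \<in> carrier_mat m m"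
    using K Y by auto
  have "(1\<^sub>m m + K) * Y * (1\<^sub>m m - K) = (Y + K * Y) * (1\<^sub>m m - K)"
    using K Y by (simp add: add_mult_distrib_mat[OF one_carrier_mat K Y])
  also have "\<dots> = (Y + K * Y) - (Y + K * Y) * K"
    using K Y KY by (subst mult_minus_distrib_mat[of _ m m]) auto
  also have "(Y + K * Y) * K = Y * K + K * (Y * K)"
    using K Y KY by (subst add_mult_distrib_mat[of _ m m]) (auto simp: assoc_mult_mat[OF K Y K])
  finally have "(1\<^sub>m m + K) * Y * (1\<^sub>m m - K) = (Y + K * Y) - (Y * K + K * (Y * K))" .
  then show "(1\<^sub>m m + K) * Y * (1\<^sub>m m - K) = Y + K * Y - Y * K - K * (Y * K)"
    using K Y KY by (auto intro!: eq_matI simp del: index_mult_mat(1))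
  have "(1\<^sub>m m - K) * Y * (1\<^sub>m m + K) = (Y - K * Y) * (1\<^sub>m m + K)"
    using K Y by (simp add: minus_mult_distrib_mat[OF one_carrier_mat K Y])
  also have "\<dots> = (Y - K * Y) + (Y - K * Y) * K"
    using K Y KY by (subst mult_add_distrib_mat[of _ m m]) auto
  also have "(Y - K * Y) * K = Y * K - K * (Y * K)"
    using K Y KY by (subst minus_mult_distrib_mat[of _ m m]) (auto simp: assoc_mult_mat[OF K Y K])
  finally have "(1\<^sub>m m - K) * Y * (1\<^sub>m m + K) = (Y - K * Y) + (Y * K - K * (Y * K))" .
  then show "(1\<^sub>m m - K) * Y * (1\<^sub>m m + K) = Y - K * Y + Y * K - K * (Y * K)"
    using K Y KY by (auto intro!: eq_matI simp del: index_mult_mat(1))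
qed

definition add_poly_mat :: "nat \<Rightarrow> nat \<Rightarrow> (nat \<Rightarrow> real) \<Rightarrow> real mat \<Rightarrow> real mat" where
  "add_poly_mat m d f A = mat m m (\<lambda>ij. A $$ ij + (\<Sum>k<d. f k * (A ^\<^sub>m k) $$ ij))"

lemma pow_mat_symmetric:
  assumes "symmetric_mat m A"
  shows "symmetric_mat m (A ^\<^sub>m k)"
proof (induction k)
  case 0
  then show ?case using assms by (auto simp: symmetric_mat_def)
next
  case (Suc k)
  have A: "A \<in> carrier_mat m m" "transpose_mat A = A" using assms by (auto simp: symmetric_mat_def)
  have Ak: "A ^\<^sub>m k \<in> carrier_mat m m" "transpose_mat (A ^\<^sub>m k) = A ^\<^sub>m k"
    using Suc by (auto simp: symmetric_mat_def)
  have comm: "A * A ^\<^sub>m l = A ^\<^sub>m l * A" for l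
  proof (induction l)
    case (Suc l)
    then show ?case using A(1) assoc_mult_mat[OF A(1) pow_carrier_mat[OF A(1), of l] A(1)] by simp
  qed (use A in auto)
  have "A ^\<^sub>m k * A \<in> carrier_mat m m" by (rule mult_carrier_mat[OF Ak(1) A(1)])
  moreover have "transpose_mat (A ^\<^sub>m k * A) = A ^\<^sub>m k * A"
    unfolding transpose_mult[OF Ak(1) A(1)] A(2) Ak(2) by (rule comm)
  ultimately show ?case by (simp only: symmetric_mat_def pow_mat.simps)
qed

text \<open>In the coordinates \<open>z\<close> given by the right inverse, the linear part of the
  equation is the identity, so a fixed point of the remainder solves it. Entries where
  \<open>A\<close> is nonzero are only asserted to be close to those of \<open>A\<close>; whether
  they stay nonzero depends on \<open>\<rho>\<close>.\<close>

lemma perturbation_step: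
  fixes A :: "real mat" and E :: "(nat \<times> nat) set"
  assumes A: "symmetric_mat m A" and st: "strong m d A"
    and E: "\<And>i j. (i, j) \<in> E \<Longrightarrow> (j, i) \<in> E" and "0 < \<rho>"
  shows "\<exists>B K f. symmetric_mat m B \<and> K \<in> carrier_mat m m \<and> transpose_mat K = - K \<and>
    (1\<^sub>m m + K) * B * (1\<^sub>m m - K) = (1\<^sub>m m - K) * add_poly_mat m d f A * (1\<^sub>m m + K) \<and>
    (\<forall>i<m. \<forall>j<m. \<bar>B $$ (i, j) - A $$ (i, j)\<bar> \<le> \<rho>) \<and> (\<forall>k<d. \<bar>f k\<bar> \<le> \<rho>) \<and>
    (\<forall>i<m. \<forall>j<m. i \<noteq> j \<longrightarrow> A $$ (i, j) = 0 \<longrightarrow> (B $$ (i, j) \<noteq> 0 \<longleftrightarrow> (i, j) \<in> E))"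
proof -
  define I where "I = {..<m} \<times> {..<m}"
  have I: "finite I" by (simp add: I_def)
  obtain p0 K0 f0 N0 where R: "\<And>q. admissible m A (p0 q) (K0 q) (N0 q)"
    "\<And>q i j. i < m \<Longrightarrow> j < m \<Longrightarrow>
       linearised m d A (p0 q) (K0 q) (f0 q) (N0 q) i j = (if (i, j) = q then 1 else 0)"
    using linearised_right_inverse[OF A st] by metis
  define p where "p z i j = (\<Sum>q\<in>I. z q * p0 q i j)" for z i j
  define K where "K z i j = (\<Sum>q\<in>I. z q * K0 q i j)" for z i j
  define f where "f z k = (\<Sum>q\<in>I. z q * f0 q k)" for z k
  define N where "N z i j = (\<Sum>q\<in>I. z q * N0 q i j)" for z i j
  have adm: "admissible m A (p z) (K z) (N z)" for z
    using admissible_sum[of I m A p0 K0 N0 z]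
      R(1) unfolding p_def K_def N_def by blast
  have lin: "linearised m d A (p z) (K z) (f z) (N z) i j = z (i, j)" if "i < m" "j < m" for z i j
  proof -
    have "linearised m d A (p z) (K z) (f z) (N z) i j
        = (\<Sum>q\<in>I. z q * linearised m d A (p0 q) (K0 q)
              (f0 q) (N0 q) i j)"
      unfolding p_def K_def f_def N_def by (rule linearised_sum)
    also have "\<dots> = (\<Sum>q\<in>I. if (i, j) = q then z q else 0)"
      by (intro sum.cong refl) (simp add: R(2)[OF that])
    also have "\<dots> = z (i, j)" using that I by (simp add: sum.delta I_def)
    finally show ?thesis .
  qed
  \<comment> \<open>The pattern of the edges to be switched on; \<open>s\<close> is their common
    weight.\<close>
  define t :: "nat \<Rightarrow> nat \<Rightarrow> real"
    where "t i j = (if i \<noteq> j \<and> (i, j) \<in> E \<and> A $$ (i, j) = 0 then 1 else 0)" for i j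
  define W where "W z s i j = s * t i j + p z i j" for z s i j
  define F where "F z i j = (\<Sum>k<d. f z k * (A ^\<^sub>m k) $$ (i, j))" for z i j
  have vW: "vanishing I (\<lambda>z s. W z s i j)" for i j
    unfolding W_def p_def by (rule vanishing_linear[OF I])
  have vK: "vanishing I (\<lambda>z s. K z i j)" for i j
    using vanishing_linear[OF I, of 0] unfolding K_def by simp
  have vf: "vanishing I (\<lambda>z s. f z k)" for k
    using vanishing_linear[OF I, of 0] unfolding f_def by simp
  have "F z i j = (\<Sum>q\<in>I. z q * (\<Sum>k<d. f0 q k * (A ^\<^sub>m k) $$ (i, j)))" for z i j
    unfolding F_def f_def sum_distrib_left sum_distrib_right by (subst sum.swap) (simp add: mult_ac)
  then have vF: "vanishing I (\<lambda>z s. F z i j)" for i j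
    using vanishing_linear[OF I, of 0] by simp
  \<comment> \<open>What is left of the equation after moving its linear part to the other side:
    every summand is a product of at least two small factors.\<close>
  define rest where "rest z s i j = mprod m (W z s) (K z) i j - mprod m (K z) (W z s) i j
      + (mprod m (F z) (K z) i j - mprod m (K z) (F z) i j)
      + mprod m (K z) (mprod m (\<lambda>i j. W z s i j - F z i j) (K z)) i j" for z s i j
  define h where "h q z s = rest z s (fst q) (snd q) - s * t (fst q) (snd q)" for q z s
  have vt: "vanishing I (\<lambda>z s. s * t i j)" for i j
    using vanishing_linear[OF I, of "t i j" "\<lambda>_. 0"] by simp
  have "vanishing I (h q) \<and> contractive I (h q)" if "q \<in> I" for q
    using that unfolding h_def[abs_def] rest_def I_def
    by (intro conjI vanishing_diff vanishing_add contractive_diff contractive_add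
          contractive_param vanishing_mprod vanishing_diff vt[unfolded I_def] vW[unfolded I_def]
          vK[unfolded I_def] vF[unfolded I_def]) auto
  then have h: "\<And>q. q \<in> I \<Longrightarrow> vanishing I (h q)" "\<And>q. q \<in> I \<Longrightarrow> contractive I (h q)" by auto
  obtain r1 where r1: "r1 > 0"
    "\<forall>z s. l1 I z \<le> r1 \<longrightarrow> \<bar>s\<bar> \<le> r1 \<longrightarrow> (\<forall>q\<in>I. \<bar>W z s (fst q) (snd q)\<bar> \<le> \<rho>)"
    using vanishing_uniform[of I I "\<lambda>q z s. W z s (fst q) (snd q)" \<rho>] I vW \<open>0 < \<rho>\<close> by blast
  obtain r2 where r2: "r2 > 0"
    "\<And>z s k. l1 I z \<le> r2 \<Longrightarrow> \<bar>s :: real\<bar> \<le> r2 \<Longrightarrow> k < d \<Longrightarrow> \<bar>f z k\<bar> \<le> \<rho>"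
    using vanishing_uniform[of "{..<d}" I "\<lambda>k z s. f z k" \<rho>] vf \<open>0 < \<rho>\<close> by auto
  define r where "r = min r1 r2"
  have r: "0 < r" "r \<le> r1" "r \<le> r2" using r1 r2 by (auto simp: r_def)
  obtain \<delta> where \<delta>: "\<delta> > 0" "\<And>s. \<bar>s\<bar> \<le> \<delta> \<Longrightarrow> \<exists>z. l1 I z \<le> r \<and> (\<forall>q\<in>I. z q = h q z s)"
    using contractive_system_solvable[of I h r, OF I h r(1)] by blast
  \<comment> \<open>A strictly positive weight is essential: it is the entry of \<open>B\<close> on
    each new edge.\<close>
  define s where "s = min r \<delta>"
  have s: "0 < s" "\<bar>s\<bar> \<le> r" "\<bar>s\<bar> \<le> \<delta>" using r \<delta> by (auto simp: s_def)
  obtain z where z: "l1 I z \<le> r" "\<And>q. q \<in> I \<Longrightarrow> z q = h q z s" using \<delta>(2)[OF s(3)] by auto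
  define a where "a i j = A $$ (i, j)" for i j
  have asym: "a i j = a j i" if "i < m" "j < m" for i j
    using symmetric_matD[OF A that] by (simp add: a_def)
  have Ksk: "K z i j = - K z j i" and Nsk: "N z i j = - N z j i" and psym: "p z i j = p z j i"
    if "i < m" "j < m" for i j
    using adm[of z] that unfolding admissible_def by blast+
  have Fsym: "F z i j = F z j i" if "i < m" "j < m" for i j
    unfolding F_def using symmetric_matD[OF pow_mat_symmetric[OF A] that] by simp
  have tsym: "t i j = t j i" if "i < m" "j < m" for i j
    using E symmetric_matD[OF A that] by (auto simp: t_def)
  have Wsym: "W z s i j = W z s j i" if "i < m" "j < m" for i j
    using that psym tsym by (simp add: W_def)
  have WFsym: "W z s i j - F z i j = W z s j i - F z j i" if "i < m" "j < m" for i j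
    using that Wsym Fsym by simp
  have restsym: "rest z s i j = rest z s j i" if ij: "i < m" "j < m" for i j
    using mprod_sym_skew[of m "W z s" "K z", OF Wsym Ksk ij(1,2)]
      mprod_sym_skew[of m "W z s" "K z", OF Wsym Ksk ij(2,1)]
      mprod_sym_skew[of m "F z" "K z", OF Fsym Ksk ij(1,2)]
      mprod_sym_skew[of m "F z" "K z", OF Fsym Ksk ij(2,1)]
      mprod_skew_sym_skew[of m "\<lambda>i j. W z s i j - F z i j" "K z", OF WFsym Ksk ij]
    by (simp add: rest_def)
  have eq0: "p z i j - 2 * (mprod m a (K z) i j - mprod m (K z) a i j) - F z i j + N z i j
      = rest z s i j - s * t i j" if "i < m" "j < m" for i j
    using lin[OF that, of z] z(2)[of "(i, j)"] that
    by (simp add: linearised_def h_def I_def F_def a_def[symmetric, abs_def])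
  \<comment> \<open>All other terms of \<open>eq0\<close> are symmetric in \<open>i\<close> and
    \<open>j\<close>, while \<open>N\<close> is skew. So the auxiliary term drops out and the
    genuine equation holds.\<close>
  have N0: "N z i j = 0" if ij: "i < m" "j < m" for i j
    using eq0[OF ij] eq0[OF ij(2,1)] restsym[OF ij] tsym[OF ij] psym[OF ij] Fsym[OF ij] Nsk[OF ij]
      mprod_sym_skew[of m a "K z", OF asym Ksk ij(1,2)]
      mprod_sym_skew[of m a "K z", OF asym Ksk ij(2,1)]
    by simp
  have eq: "W z s i j - 2 * (mprod m a (K z) i j - mprod m (K z) a i j) - F z i j = rest z s i j"
    if "i < m" "j < m" for i j
    using eq0[OF that] N0[OF that] by (simp add: W_def)
  define B where "B = mat m m (\<lambda>(i, j). a i j + W z s i j)"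
  define C where "C = mat m m (\<lambda>(i, j). K z i j)"
  have AF: "add_poly_mat m d (f z) A = mat m m (\<lambda>(i, j). a i j + F z i j)"
    by (auto simp: add_poly_mat_def a_def F_def)
  have carr: "B \<in> carrier_mat m m" "C \<in> carrier_mat m m" by (auto simp: B_def C_def)
  have 1: "symmetric_mat m B"
    by (rule symmetric_matI) (auto simp: B_def asym Wsym)
  have 2: "transpose_mat C = - C"
  proof (rule eq_matI)
    fix i j assume "i < dim_row (- C)" "j < dim_col (- C)"
    then have "i < m" "j < m" by (auto simp: C_def)
    then show "transpose_mat C $$ (i, j) = (- C) $$ (i, j)" using Ksk[of j i] by (simp add: C_def)
  qed (simp_all add: C_def)
  have 3: "(1\<^sub>m m + C) * B * (1\<^sub>m m - C) = (1\<^sub>m m - C) * add_poly_mat m d (f z) A * (1\<^sub>m m + C)"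
  proof -
    have AFc: "mat m m (\<lambda>(i, j). a i j + F z i j) \<in> carrier_mat m m" by simp
    show ?thesis
      unfolding AF cayley_expand(1)[OF carr(2,1)] cayley_expand(2)[OF carr(2) AFc]
      unfolding B_def C_def mat_mprod
    proof (rule eq_matI, goal_cases)
      case (1 i j)
      then have ij: "i < m" "j < m" by auto
      have "a i j + W z s i j + mprod m (K z) (\<lambda>i j. a i j + W z s i j) i j -
           mprod m (\<lambda>i j. a i j + W z s i j) (K z) i j -
           mprod m (K z) (mprod m (\<lambda>i j. a i j + W z s i j) (K z)) i j =
           a i j + F z i j - mprod m (K z) (\<lambda>i j. a i j + F z i j) i j +
           mprod m (\<lambda>i j. a i j + F z i j) (K z) i j -
           mprod m (K z) (mprod m (\<lambda>i j. a i j + F z i j) (K z)) i j"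
        using eq[OF ij] unfolding rest_def
        by (simp add: mprod_add_left[abs_def] mprod_add_right mprod_diff_left[abs_def] mprod_diff_right)
      then show ?case using ij by simp
    qed simp_all
  qed
  have 4: "\<bar>B $$ (i, j) - A $$ (i, j)\<bar> \<le> \<rho>" if "i < m" "j < m" for i j
    using r1(2)[rule_format, of z s "(i, j)"] z(1) s r that by (simp add: B_def a_def I_def)
  have 5: "\<bar>f z k\<bar> \<le> \<rho>" if "k < d" for k
    using r2(2)[of z s k] z(1) s r that by simp
  have 6: "B $$ (i, j) \<noteq> 0 \<longleftrightarrow> (i, j) \<in> E"
    if ij: "i < m" "j < m" and "i \<noteq> j" "A $$ (i, j) = 0" for i j
  proof -
    have "p z i j = 0" using adm[of z] that unfolding admissible_def by blast
    then show ?thesis using that s by (simp add: B_def a_def W_def t_def)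
  qed
  show ?thesis using 1 2 3 4 5 6 carr(2) by blast
qed

section \<open>Supergraphs on the same vertex set\<close>

lemma tendsto_pow_mat:
  fixes B :: "nat \<Rightarrow> real mat"
  assumes B: "\<And>n. B n \<in> carrier_mat m m" and A: "A \<in> carrier_mat m m"
    and lim: "\<And>i j. i < m \<Longrightarrow> j < m \<Longrightarrow> (\<lambda>n. B n $$ (i, j)) \<longlonglongrightarrow> A $$ (i, j)"
    and "i < m" "j < m"
  shows "(\<lambda>n. (B n ^\<^sub>m k) $$ (i, j)) \<longlonglongrightarrow> (A ^\<^sub>m k) $$ (i, j)"
  using assms(4,5)
proof (induction k arbitrary: i j)
  case 0
  have "dim_row (B n) = m" for n using B by auto
  then show ?case using A 0 by simp
next
  case (Suc k)
  have 1: "(B n ^\<^sub>m Suc k) $$ (i, j) = (\<Sum>l<m. (B n ^\<^sub>m k) $$ (i, l) * B n $$ (l, j))" for n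
    using mat_mult_index[OF pow_carrier_mat[OF B] B Suc.prems] by simp
  have 2: "(A ^\<^sub>m Suc k) $$ (i, j) = (\<Sum>l<m. (A ^\<^sub>m k) $$ (i, l) * A $$ (l, j))"
    using mat_mult_index[OF pow_carrier_mat[OF A] A Suc.prems] by simp
  show ?case unfolding 1 2
    by (intro tendsto_sum tendsto_mult Suc.IH lim) (use Suc.prems in auto)
qed

text \<open>The duality of \<open>linearised_surj\<close> read backwards. The direction
  \<open>p\<close> need only vanish where \<open>B\<close> does, so directions admissible for
  \<open>A\<close> can be used at a nearby \<open>B\<close> whose pattern contains that of
  \<open>A\<close>.\<close>

lemma orth_linearised:
  assumes B: "symmetric_mat m B" and X: "symmetric_mat m X"
    and supp: "\<And>i j. i < m \<Longrightarrow> j < m \<Longrightarrow> B $$ (i, j) \<noteq> 0 \<or> i = j \<Longrightarrow> X $$ (i, j) = 0"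
    and comm: "B * X = X * B" and pow: "\<And>k. k < d \<Longrightarrow> frob m (B ^\<^sub>m k) X = 0"
    and p: "\<And>i j. i < m \<Longrightarrow> j < m \<Longrightarrow> i \<noteq> j \<Longrightarrow> B $$ (i, j) = 0 \<Longrightarrow> p i j = 0"
    and N: "\<And>i j. i < m \<Longrightarrow> j < m \<Longrightarrow> N i j = - N j i"
  shows "(\<Sum>i<m. \<Sum>j<m. X $$ (i, j) * linearised m d B p K f N i j) = 0"
proof -
  define b where "b i j = B $$ (i, j)" for i j
  define x where "x i j = X $$ (i, j)" for i j
  have x: "x i j = x j i" if "i < m" "j < m" for i j
    using symmetric_matD[OF X that] by (simp add: x_def)
  have "(\<Sum>i<m. \<Sum>j<m. x i j * p i j) = 0"
    by (intro sum.neutral ballI) (use supp p in \<open>auto simp: x_def\<close>)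
  moreover have "(\<Sum>i<m. \<Sum>j<m. x i j * N i j) = 0"
  proof -
    have "(\<Sum>i<m. \<Sum>j<m. x i j * N i j) = (\<Sum>j<m. \<Sum>i<m. x i j * N i j)" by (rule sum.swap)
    also have "\<dots> = (\<Sum>j<m. \<Sum>i<m. - (x j i * N j i))"
    proof (intro sum.cong refl)
      fix i j assume "i \<in> {..<m}" "j \<in> {..<m}"
      then show "x i j * N i j = - (x j i * N j i)" using x[of i j] N[of i j] by simp
    qed
    also have "\<dots> = - (\<Sum>i<m. \<Sum>j<m. x i j * N i j)" by (simp add: sum_negf)
    finally show ?thesis by simp
  qed
  moreover have "(\<Sum>i<m. \<Sum>j<m. x i j * (mprod m b K i j - mprod m K b i j)) = 0"
  proof -
    have "mprod m b x i j - mprod m x b i j = 0" if "i < m" "j < m" for i j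
    proof -
      have "(B * X) $$ (i, j) = (X * B) $$ (i, j)" by (simp add: comm)
      then show ?thesis
        unfolding mat_mult_index[OF symmetric_mat_carrier[OF B] symmetric_mat_carrier[OF X] that]
          mat_mult_index[OF symmetric_mat_carrier[OF X] symmetric_mat_carrier[OF B] that]
        by (simp add: mprod_def b_def x_def)
    qed
    moreover have "b i j = b j i" if "i < m" "j < m" for i j
      using symmetric_matD[OF B that] by (simp add: b_def)
    ultimately show ?thesis
      using commutator_adjoint[where m = m and a = b and x = x and K = K] by simp
  qed
  moreover have "(\<Sum>i<m. \<Sum>j<m. x i j * (\<Sum>k<d. f k * (B ^\<^sub>m k) $$ (i, j))) = 0"
  proof -
    have "(\<Sum>i<m. \<Sum>j<m. x i j * (\<Sum>k<d. f k * (B ^\<^sub>m k) $$ (i, j)))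
        = (\<Sum>i<m. \<Sum>j<m. \<Sum>k<d. f k * ((B ^\<^sub>m k) $$ (i, j) * x i j))"
      by (simp add: sum_distrib_left mult_ac)
    also have "\<dots> = (\<Sum>i<m. \<Sum>k<d. \<Sum>j<m. f k * ((B ^\<^sub>m k) $$ (i, j) * x i j))"
      by (intro sum.cong refl sum.swap)
    also have "\<dots> = (\<Sum>k<d. f k * frob m (B ^\<^sub>m k) X)"
      unfolding frob_def sum_distrib_left by (subst sum.swap) (simp add: x_def)
    finally show ?thesis by (simp add: pow)
  qed
  moreover have "x i j * linearised m d B p K f N i j = x i j * p i j
      - 2 * (x i j * (mprod m b K i j - mprod m K b i j))
      - x i j * (\<Sum>k<d. f k * (B ^\<^sub>m k) $$ (i, j)) + x i j * N i j" for i j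
    by (simp add: linearised_def b_def[symmetric, abs_def] algebra_simps)
  ultimately show ?thesis
    by (simp add: x_def[symmetric] sum.distrib sum_subtractf sum_distrib_left[symmetric])
qed

lemma eventually_strong:
  fixes B :: "nat \<Rightarrow> real mat"
  assumes A: "symmetric_mat m A" and st: "strong m d A" and B: "\<And>n. symmetric_mat m (B n)"
    and lim: "\<And>i j. i < m \<Longrightarrow> j < m \<Longrightarrow> (\<lambda>n. B n $$ (i, j)) \<longlonglongrightarrow> A $$ (i, j)"
  shows "eventually (\<lambda>n. strong m d (B n)) sequentially"
proof -
  let ?I = "{..<m} \<times> {..<m}"
  obtain p K f N where adm: "\<And>q. admissible m A (p q) (K q) (N q)"
    and lin: "\<And>q i j. i < m \<Longrightarrow> j < m \<Longrightarrow>
       linearised m d A (p q) (K q) (f q) (N q) i j = (if (i, j) = q then 1 else 0)"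
    using linearised_right_inverse[OF A st] by metis
  \<comment> \<open>The bound on the entries of \<open>X\<close> sums up to
    \<open>S \<le> m * m * \<theta> * S\<close>, and this \<open>\<theta>\<close> makes the factor
    less than 1, so that \<open>S\<close> vanishes.\<close>
  define \<theta> where "\<theta> = 1 / (real m * real m + 1)"
  have \<theta>: "0 < \<theta>" by (simp add: \<theta>_def add_nonneg_pos)
  note carr = symmetric_mat_carrier[OF B] symmetric_mat_carrier[OF A]
  define D where "D n q i j = linearised m d A (p q) (K q) (f q) (N q) i j
      - linearised m d (B n) (p q) (K q) (f q) (N q) i j" for n q i j
  have "eventually (\<lambda>n. \<bar>D n q (fst r) (snd r)\<bar> < \<theta>) sequentially" if "r \<in> ?I" for q r
  proof -
    have "(\<lambda>n. linearised m d (B n) (p q) (K q) (f q) (N q) (fst r) (snd r))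
        \<longlonglongrightarrow> linearised m d A (p q) (K q) (f q) (N q) (fst r) (snd r)"
      unfolding linearised_def mprod_def
      by (intro tendsto_intros lim tendsto_pow_mat[OF carr] ) (use that in auto)
    then have "(\<lambda>n. \<bar>D n q (fst r) (snd r)\<bar>) \<longlonglongrightarrow> \<bar>linearised m d A (p q) (K q) (f q) (N q) (fst r) (snd r)
      - linearised m d A (p q) (K q) (f q) (N q) (fst r) (snd r)\<bar>"
      unfolding D_def by (intro tendsto_intros)
    then have "(\<lambda>n. \<bar>D n q (fst r) (snd r)\<bar>) \<longlonglongrightarrow> 0" by simp
    from order_tendstoD(2)[OF this \<theta>] show ?thesis .
  qed
  then have ev1: "eventually (\<lambda>n. \<forall>q\<in>?I. \<forall>r\<in>?I. \<bar>D n q (fst r) (snd r)\<bar> < \<theta>) sequentially"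
    by (intro eventually_ball_finite ballI) auto
  \<comment> \<open>Near \<open>A\<close> the pattern can only grow. This lets the preimages chosen
    at \<open>A\<close> serve as directions at \<open>B n\<close>.\<close>
  have "eventually (\<lambda>n. A $$ r \<noteq> 0 \<longrightarrow> B n $$ r \<noteq> 0) sequentially" if "r \<in> ?I" for r
  proof (cases "A $$ r = 0")
    case False
    have "(\<lambda>n. B n $$ r) \<longlonglongrightarrow> A $$ r" using lim that by auto
    from tendsto_imp_eventually_ne[OF this False] show ?thesis by eventually_elim simp
  qed simp
  then have ev2: "eventually (\<lambda>n. \<forall>r\<in>?I. A $$ r \<noteq> 0 \<longrightarrow> B n $$ r \<noteq> 0) sequentially"
    by (intro eventually_ball_finite ballI) auto
  show ?thesis using ev1 ev2
  proof eventually_elim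
    case (elim n)
    show ?case unfolding strong_def
    proof (intro allI impI)
      fix X assume X: "symmetric_mat m X"
        and supp: "\<forall>i<m. \<forall>j<m. B n $$ (i, j) \<noteq> 0 \<or> i = j \<longrightarrow> X $$ (i, j) = 0"
        and comm: "B n * X = X * B n" and pow: "\<forall>k<d. frob m (B n ^\<^sub>m k) X = 0"
      \<comment> \<open>\<open>X\<close> is orthogonal to the range of the linearisation at \<open>B n\<close>, which is close to the one
        at \<open>A\<close>; as the latter is onto, every entry of \<open>X\<close> is a small multiple of the norm of \<open>X\<close>.\<close>
      define S where "S = (\<Sum>i<m. \<Sum>j<m. \<bar>X $$ (i, j)\<bar>)"
      have bound: "\<bar>X $$ (a, b)\<bar> \<le> \<theta> * S" if ab: "a < m" "b < m" for a b
      proof -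
        let ?q = "(a, b)"
        have "(\<Sum>i<m. \<Sum>j<m. X $$ (i, j) * linearised m d A (p ?q) (K ?q) (f ?q) (N ?q) i j)
            = (\<Sum>i<m. \<Sum>j<m. if i = a then if j = b then X $$ (a, b) else 0 else 0)"
          by (intro sum.cong refl) (auto simp: lin)
        also have "\<dots> = (\<Sum>i<m. if i = a then (\<Sum>j<m. if j = b then X $$ (a, b) else 0) else 0)"
          by (intro sum.cong refl) auto
        also have "\<dots> = X $$ (a, b)" using ab by simp
        finally have 1: "(\<Sum>i<m. \<Sum>j<m. X $$ (i, j) * linearised m d A (p ?q) (K ?q) (f ?q) (N ?q) i j)
          = X $$ (a, b)" .
        have 2: "(\<Sum>i<m. \<Sum>j<m. X $$ (i, j) * linearised m d (B n) (p ?q) (K ?q) (f ?q) (N ?q) i j) = 0"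
        proof (rule orth_linearised[OF B X _ comm])
          show "p ?q i j = 0" if "i < m" "j < m" "i \<noteq> j" "B n $$ (i, j) = 0" for i j
          proof -
            have "A $$ (i, j) = 0" using elim(2) that by force
            then show ?thesis using adm[of ?q] that unfolding admissible_def by blast
          qed
          show "N ?q i j = - N ?q j i" if "i < m" "j < m" for i j
            using adm[of ?q] that unfolding admissible_def by blast
        qed (use supp pow in blast)+
        have "X $$ (a, b) = (\<Sum>i<m. \<Sum>j<m. X $$ (i, j) * D n ?q i j)"
          unfolding D_def right_diff_distrib sum_subtractf 1 2 by simp
        also have "\<bar>\<dots>\<bar> \<le> (\<Sum>i<m. \<Sum>j<m. \<theta> * \<bar>X $$ (i, j)\<bar>)"
        proof (rule order_trans[OF sum_abs], rule sum_mono, rule order_trans[OF sum_abs], rule sum_mono)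
          fix i j assume "i \<in> {..<m}" "j \<in> {..<m}"
          then have "\<bar>D n ?q i j\<bar> \<le> \<theta>" using elim(1)[rule_format, of ?q "(i, j)"] ab by simp
          then show "\<bar>X $$ (i, j) * D n ?q i j\<bar> \<le> \<theta> * \<bar>X $$ (i, j)\<bar>"
            unfolding abs_mult by (subst mult.commute) (rule mult_right_mono, auto)
        qed
        also have "\<dots> = \<theta> * S" by (simp add: S_def sum_distrib_left)
        finally show ?thesis .
      qed
      have S0: "0 \<le> S" by (simp add: S_def sum_nonneg)
      have "S \<le> (\<Sum>i<m. \<Sum>j<m. \<theta> * S)"
        unfolding S_def by (intro sum_mono) (use bound in \<open>simp add: S_def\<close>)
      also have "\<dots> = (real m * real m * \<theta>) * S" by simp
      finally have "(1 - real m * real m * \<theta>) * S \<le> 0" by (simp add: algebra_simps)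
      moreover have "0 < real m * real m + 1" by (simp add: add_nonneg_pos)
      then have "1 - real m * real m * \<theta> > 0" by (simp add: \<theta>_def pos_divide_less_eq)
      ultimately have "S \<le> 0" by (simp add: mult_le_0_iff)
      then have "S = 0" using S0 by simp
      then have "X $$ (a, b) = 0" if "a < m" "b < m" for a b using bound[OF that] by simp
      then show "X = 0\<^sub>m m m" using symmetric_mat_carrier[OF X] by (auto intro!: eq_matI)
    qed
  qed
qed

section \<open>Cayley transforms and similarity\<close>

text \<open>A skew matrix has the zero quadratic form, so pairing \<open>v + K v = 0\<close> with
  \<open>v\<close> leaves the squared norm of \<open>v\<close> equal to 0.\<close>

lemma skew_one_plus_inverse:
  fixes K :: "real mat"
  assumes K: "K \<in> carrier_mat m m" and skew: "transpose_mat K = - K"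
  obtains M where "M \<in> carrier_mat m m" "M * (1\<^sub>m m + K) = 1\<^sub>m m" "(1\<^sub>m m + K) * M = 1\<^sub>m m"
proof -
  have Kij: "K $$ (i, j) = - K $$ (j, i)" if "i < m" "j < m" for i j
  proof -
    have "transpose_mat K $$ (j, i) = (- K) $$ (j, i)" by (simp only: skew)
    then show ?thesis using that K by simp
  qed
  have carr: "1\<^sub>m m + K \<in> carrier_mat m m" using K by simp
  have "det (1\<^sub>m m + K) \<noteq> 0"
  proof
    assume "det (1\<^sub>m m + K) = 0"
    then obtain v where v: "v \<in> carrier_vec m" "v \<noteq> 0\<^sub>v m" "(1\<^sub>m m + K) *\<^sub>v v = 0\<^sub>v m"
      unfolding det_0_iff_vec_prod_zero[OF carr] by blast
    have row: "v $ i + (\<Sum>j<m. K $$ (i, j) * v $ j) = 0" if i: "i < m" for i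
    proof -
      have "((1\<^sub>m m + K) *\<^sub>v v) $ i = (\<Sum>j<m. (1\<^sub>m m + K) $$ (i, j) * v $ j)"
        using K v(1) i by (auto simp: scalar_prod_def lessThan_atLeast0 intro!: sum.cong)
      also have "\<dots> = (\<Sum>j<m. (if j = i then v $ j else 0) + K $$ (i, j) * v $ j)"
        using K i by (intro sum.cong refl) (auto simp: distrib_right)
      also have "\<dots> = v $ i + (\<Sum>j<m. K $$ (i, j) * v $ j)"
        using i by (simp add: sum.distrib)
      finally show ?thesis using v(3) i by simp
    qed
    define T where "T = (\<Sum>i<m. \<Sum>j<m. v $ i * (K $$ (i, j) * v $ j))"
    have "T = (\<Sum>j<m. \<Sum>i<m. v $ i * (K $$ (i, j) * v $ j))" unfolding T_def by (rule sum.swap)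
    also have "\<dots> = (\<Sum>j<m. \<Sum>i<m. - (v $ j * (K $$ (j, i) * v $ i)))"
    proof (intro sum.cong refl)
      fix i j assume "i \<in> {..<m}" "j \<in> {..<m}"
      then show "v $ i * (K $$ (i, j) * v $ j) = - (v $ j * (K $$ (j, i) * v $ i))"
        using Kij[of i j] by simp
    qed
    also have "\<dots> = - T" by (simp add: T_def sum_negf)
    finally have "T = 0" by simp
    have "0 = (\<Sum>i<m. v $ i * (v $ i + (\<Sum>j<m. K $$ (i, j) * v $ j)))" by (simp add: row)
    also have "\<dots> = (\<Sum>i<m. v $ i * v $ i) + T"
      by (simp add: T_def distrib_left sum.distrib sum_distrib_left)
    finally have "(\<Sum>i<m. v $ i * v $ i) = 0" using \<open>T = 0\<close> by simp
    then have "v $ i = 0" if "i < m" for i using that by (simp add: sum_nonneg_eq_0_iff)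
    then show False using v(1,2) by (auto intro!: eq_vecI)
  qed
  from det_non_zero_imp_unit[OF carr this, of "()"] show thesis
    using that unfolding Units_def ring_mat_def by auto
qed

text \<open>With \<open>U = I + K\<close> and \<open>V = I - K\<close>, both invertible, the
  equation says that \<open>B\<close> is the product of \<open>U^-1 V\<close>, \<open>C\<close> and
  \<open>U V^-1\<close>. The two outer factors are mutually inverse because \<open>U\<close> and
  \<open>V\<close> commute.\<close>

lemma char_poly_cayley:
  fixes K B C :: "real mat"
  assumes K: "K \<in> carrier_mat m m" and skew: "transpose_mat K = - K"
    and B: "B \<in> carrier_mat m m" and C: "C \<in> carrier_mat m m"
    and eq: "(1\<^sub>m m + K) * B * (1\<^sub>m m - K) = (1\<^sub>m m - K) * C * (1\<^sub>m m + K)"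
  shows "char_poly B = char_poly C"
proof -
  define U where "U = 1\<^sub>m m + K"
  define V where "V = 1\<^sub>m m - K"
  have U: "U \<in> carrier_mat m m" and V: "V \<in> carrier_mat m m" using K by (auto simp: U_def V_def)
  have V': "V = 1\<^sub>m m + (- K)" unfolding V_def using K by (auto intro!: eq_matI)
  obtain M where M: "M \<in> carrier_mat m m" "M * U = 1\<^sub>m m" "U * M = 1\<^sub>m m"
    unfolding U_def by (rule skew_one_plus_inverse[OF K skew])
  have "transpose_mat (- K) = - (- K)" using skew K by (simp add: transpose_uminus)
  then obtain L where L: "L \<in> carrier_mat m m" "L * V = 1\<^sub>m m" "V * L = 1\<^sub>m m"
    unfolding V' using skew_one_plus_inverse[of "- K" m] K by auto
  note assoc = assoc_mult_mat[of _ m m _ m _ m]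
  \<comment> \<open>Both expansions of \<open>cayley_expand\<close> agree when \<open>Y\<close> is
    the identity.\<close>
  have cm: "V * U = U * V"
  proof -
    have "U * 1\<^sub>m m * V = 1\<^sub>m m + K * 1\<^sub>m m - 1\<^sub>m m * K - K * (1\<^sub>m m * K)"
      "V * 1\<^sub>m m * U = 1\<^sub>m m - K * 1\<^sub>m m + 1\<^sub>m m * K - K * (1\<^sub>m m * K)"
      unfolding U_def V_def by (intro cayley_expand K one_carrier_mat)+
    moreover have "1\<^sub>m m + K * 1\<^sub>m m - 1\<^sub>m m * K = 1\<^sub>m m - K * 1\<^sub>m m + 1\<^sub>m m * K"
      using K by (auto intro!: eq_matI)
    ultimately show ?thesis using U V by simp
  qed
  have B': "B = (M * V) * C * (U * L)"
  proof -
    have "B = (M * U) * B * (V * L)" unfolding M(2) L(3) using B by simp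
    also have "\<dots> = M * (U * B * V) * L" using B M(1) L(1) U V by (simp add: assoc)
    also have "\<dots> = M * (V * C * U) * L" using eq by (simp only: U_def V_def)
    also have "\<dots> = (M * V) * C * (U * L)" using C M(1) L(1) U V by (simp add: assoc)
    finally show ?thesis .
  qed
  have "(M * V) * (U * L) = M * (V * U) * L" using M(1) L(1) U V by (simp add: assoc)
  also have "\<dots> = (M * U) * (V * L)" unfolding cm using M(1) L(1) U V by (simp add: assoc)
  finally have PQ: "(M * V) * (U * L) = 1\<^sub>m m" using M L by simp
  have carr: "M * V \<in> carrier_mat m m" "U * L \<in> carrier_mat m m" using M L U V by auto
  have QP: "(U * L) * (M * V) = 1\<^sub>m m" by (rule mat_mult_left_right_inverse[OF carr PQ])
  have "similar_mat_wit B C (M * V) (U * L)"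
    by (rule similar_mat_witI[OF PQ QP B' B C carr])
  then show ?thesis by (intro char_poly_similar) (auto simp: similar_mat_def)
qed

text \<open>Perturbations of size \<open>1 / (n + 1)\<close> are taken along a sequence. Three open
  conditions hold for all large \<open>n\<close>: the strong property, nonvanishing on the old
  edges, and the order of the shifted points of the finite set \<open>S\<close>, later the
  eigenvalues. The pattern off the old edges is right for every \<open>n\<close>.\<close>

lemma strong_supergraph:
  fixes A :: "real mat" and E :: "(nat \<times> nat) set" and S :: "real set"
  assumes A: "symmetric_mat m A" and st: "strong m d A"
    and E: "\<And>i j. (i, j) \<in> E \<Longrightarrow> (j, i) \<in> E"
    and sub: "\<And>i j. i < m \<Longrightarrow> j < m \<Longrightarrow> i \<noteq> j \<Longrightarrow> A $$ (i, j) \<noteq> 0 \<Longrightarrow> (i, j) \<in> E"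
    and S: "finite S"
  shows "\<exists>B f. symmetric_mat m B \<and> strong m d B \<and>
    (\<forall>i<m. \<forall>j<m. i \<noteq> j \<longrightarrow> (B $$ (i, j) \<noteq> 0 \<longleftrightarrow> (i, j) \<in> E)) \<and>
    char_poly B = char_poly (add_poly_mat m d f A) \<and>
    (\<forall>x\<in>S. \<forall>y\<in>S. x < y \<longrightarrow> x + (\<Sum>k<d. f k * x ^ k) < y + (\<Sum>k<d. f k * y ^ k))"
proof -
  define P where "P n r \<longleftrightarrow> symmetric_mat m (fst r) \<and>
    char_poly (fst r) = char_poly (add_poly_mat m d (snd r) A) \<and>
    (\<forall>i<m. \<forall>j<m. \<bar>fst r $$ (i, j) - A $$ (i, j)\<bar> \<le> 1 / real (Suc n)) \<and>
    (\<forall>k<d. \<bar>snd r k\<bar> \<le> 1 / real (Suc n)) \<and>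
    (\<forall>i<m. \<forall>j<m. i \<noteq> j \<longrightarrow> A $$ (i, j) = 0 \<longrightarrow> (fst r $$ (i, j) \<noteq> 0 \<longleftrightarrow> (i, j) \<in> E))"
    for n and r :: "real mat \<times> (nat \<Rightarrow> real)"
  have "\<exists>r. P n r" for n
  proof -
    obtain B K f where *: "symmetric_mat m B" "K \<in> carrier_mat m m" "transpose_mat K = - K"
      "(1\<^sub>m m + K) * B * (1\<^sub>m m - K) = (1\<^sub>m m - K) * add_poly_mat m d f A * (1\<^sub>m m + K)"
      "\<forall>i<m. \<forall>j<m. \<bar>B $$ (i, j) - A $$ (i, j)\<bar> \<le> 1 / real (Suc n)" "\<forall>k<d. \<bar>f k\<bar> \<le> 1 / real (Suc n)"
      "\<forall>i<m. \<forall>j<m. i \<noteq> j \<longrightarrow> A $$ (i, j) = 0 \<longrightarrow> (B $$ (i, j) \<noteq> 0 \<longleftrightarrow> (i, j) \<in> E)"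
      using perturbation_step[OF A st E, of "1 / real (Suc n)"] by auto
    have "add_poly_mat m d f A \<in> carrier_mat m m" by (simp add: add_poly_mat_def)
    from char_poly_cayley[OF *(2,3) symmetric_mat_carrier[OF *(1)] this *(4)] *
    show ?thesis by (intro exI[of _ "(B, f)"]) (simp add: P_def)
  qed
  then obtain R where R: "\<And>n. P n (R n)" by metis
  define B where "B n = fst (R n)" for n
  define f where "f n = snd (R n)" for n
  have B: "symmetric_mat m (B n)" and cp: "char_poly (B n) = char_poly (add_poly_mat m d (f n) A)"
    and Bclose: "i < m \<Longrightarrow> j < m \<Longrightarrow> \<bar>B n $$ (i, j) - A $$ (i, j)\<bar> \<le> 1 / real (Suc n)"
    and fclose: "k < d \<Longrightarrow> \<bar>f n k\<bar> \<le> 1 / real (Suc n)"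
    and pat: "i < m \<Longrightarrow> j < m \<Longrightarrow> i \<noteq> j \<Longrightarrow> A $$ (i, j) = 0 \<Longrightarrow> (B n $$ (i, j) \<noteq> 0 \<longleftrightarrow> (i, j) \<in> E)"
    for n i j k
    using R[of n] unfolding P_def B_def f_def by blast+
  have lim0: "(\<lambda>n. 1 / real (Suc n)) \<longlonglongrightarrow> 0"
    using LIMSEQ_inverse_real_of_nat by (simp add: inverse_eq_divide)
  have limB: "(\<lambda>n. B n $$ (i, j)) \<longlonglongrightarrow> A $$ (i, j)" if "i < m" "j < m" for i j
    by (rule LIM_zero_cancel, rule tendsto_0_le[OF lim0, of _ 1]) (use Bclose[OF that] in simp)
  have limf: "(\<lambda>n. f n k) \<longlonglongrightarrow> 0" if "k < d" for k
    by (rule tendsto_0_le[OF lim0, of _ 1]) (use fclose[OF that] in simp)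
  have ev1: "eventually (\<lambda>n. strong m d (B n)) sequentially"
    by (rule eventually_strong[OF A st B limB])
  have "eventually (\<lambda>n. A $$ r \<noteq> 0 \<longrightarrow> B n $$ r \<noteq> 0) sequentially"
    if "r \<in> {..<m} \<times> {..<m}" for r
  proof (cases "A $$ r = 0")
    case False
    have "(\<lambda>n. B n $$ r) \<longlonglongrightarrow> A $$ r" using limB that by auto
    from tendsto_imp_eventually_ne[OF this False] show ?thesis by eventually_elim simp
  qed simp
  then have ev2: "eventually (\<lambda>n. \<forall>r\<in>{..<m} \<times> {..<m}. A $$ r \<noteq> 0 \<longrightarrow> B n $$ r \<noteq> 0) sequentially"
    by (intro eventually_ball_finite ballI) auto
  have "eventually (\<lambda>n. x < y \<longrightarrow> x + (\<Sum>k<d. f n k * x ^ k) < y + (\<Sum>k<d. f n k * y ^ k)) sequentially"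
    for x y :: real
  proof (cases "x < y")
    case True
    have "(\<lambda>n. (y + (\<Sum>k<d. f n k * y ^ k)) - (x + (\<Sum>k<d. f n k * x ^ k)))
        \<longlonglongrightarrow> (y + (\<Sum>k<d. 0 * y ^ k)) - (x + (\<Sum>k<d. 0 * x ^ k))"
      by (intro tendsto_intros limf) auto
    then have "(\<lambda>n. (y + (\<Sum>k<d. f n k * y ^ k)) - (x + (\<Sum>k<d. f n k * x ^ k))) \<longlonglongrightarrow> y - x" by simp
    from order_tendstoD(1)[OF this, of 0] True
    have "eventually (\<lambda>n. 0 < (y + (\<Sum>k<d. f n k * y ^ k)) - (x + (\<Sum>k<d. f n k * x ^ k))) sequentially"
      by simp
    then show ?thesis by eventually_elim simp
  qed simp
  then have ev3: "eventually (\<lambda>n. \<forall>x\<in>S. \<forall>y\<in>S. x < y \<longrightarrow>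
      x + (\<Sum>k<d. f n k * x ^ k) < y + (\<Sum>k<d. f n k * y ^ k)) sequentially"
    using S by (intro eventually_ball_finite ballI) auto
  have "eventually (\<lambda>n. strong m d (B n) \<and> (\<forall>r\<in>{..<m} \<times> {..<m}. A $$ r \<noteq> 0 \<longrightarrow> B n $$ r \<noteq> 0) \<and>
     (\<forall>x\<in>S. \<forall>y\<in>S. x < y \<longrightarrow> x + (\<Sum>k<d. f n k * x ^ k) < y + (\<Sum>k<d. f n k * y ^ k))) sequentially"
    using ev1 ev2 ev3 by eventually_elim blast
  from eventually_happens'[OF sequentially_bot this] obtain n where n: "strong m d (B n)"
    "\<forall>r\<in>{..<m} \<times> {..<m}. A $$ r \<noteq> 0 \<longrightarrow> B n $$ r \<noteq> 0"
    "\<forall>x\<in>S. \<forall>y\<in>S. x < y \<longrightarrow> x + (\<Sum>k<d. f n k * x ^ k) < y + (\<Sum>k<d. f n k * y ^ k)" by blast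
  have "B n $$ (i, j) \<noteq> 0 \<longleftrightarrow> (i, j) \<in> E" if "i < m" "j < m" "i \<noteq> j" for i j
  proof (cases "A $$ (i, j) = 0")
    case False
    then show ?thesis using n(2) sub that by force
  qed (use pat that in blast)
  then show ?thesis using B cp n by blast
qed

section \<open>Spectra of symmetric matrices\<close>

text \<open>For an eigenvector \<open>v\<close> the Hermitian form \<open>T\<close> of
  \<open>A\<close> at \<open>v\<close> is its own conjugate and equals \<open>k\<close> times the
  squared norm \<open>N\<close>, so \<open>k = T / N\<close> is real.\<close>

lemma symmetric_eigenvalue_real:
  assumes A: "symmetric_mat n A" and k: "eigenvalue (map_mat complex_of_real A) k"
  shows "k \<in> \<real>"
proof -
  have carr: "A \<in> carrier_mat n n" by (rule symmetric_mat_carrier[OF A])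
  obtain v where v: "v \<in> carrier_vec n" "v \<noteq> 0\<^sub>v n" "map_mat complex_of_real A *\<^sub>v v = k \<cdot>\<^sub>v v"
    using k carr unfolding eigenvalue_def eigenvector_def by auto
  have row: "(\<Sum>j<n. complex_of_real (A $$ (i, j)) * v $ j) = k * v $ i" if i: "i < n" for i
  proof -
    have "(map_mat complex_of_real A *\<^sub>v v) $ i = (\<Sum>j<n. complex_of_real (A $$ (i, j)) * v $ j)"
      using carr v(1) i by (auto simp: scalar_prod_def lessThan_atLeast0 intro!: sum.cong)
    then show ?thesis using v(1,3) i by simp
  qed
  define N where "N = (\<Sum>i<n. cnj (v $ i) * v $ i)"
  define T where "T = (\<Sum>i<n. \<Sum>j<n. cnj (v $ i) * (complex_of_real (A $$ (i, j)) * v $ j))"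
  have TN: "T = k * N"
  proof -
    have "T = (\<Sum>i<n. cnj (v $ i) * (k * v $ i))"
      unfolding T_def sum_distrib_left[symmetric] by (intro sum.cong refl) (simp add: row)
    then show ?thesis by (simp add: N_def sum_distrib_left mult_ac)
  qed
  have "cnj T = (\<Sum>i<n. \<Sum>j<n. v $ i * (complex_of_real (A $$ (i, j)) * cnj (v $ j)))"
    by (simp add: T_def)
  also have "\<dots> = (\<Sum>j<n. \<Sum>i<n. v $ i * (complex_of_real (A $$ (i, j)) * cnj (v $ j)))"
    by (rule sum.swap)
  also have "\<dots> = T"
    unfolding T_def by (intro sum.cong refl) (auto simp: symmetric_matD[OF A] mult_ac)
  finally have T: "cnj T = T" .
  have N: "N = of_real (\<Sum>i<n. (cmod (v $ i))\<^sup>2)"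
    by (simp add: N_def complex_norm_square mult.commute del: of_real_power)
  have "N \<noteq> 0"
  proof
    assume "N = 0"
    then have "(\<Sum>i<n. (cmod (v $ i))\<^sup>2) = 0" by (simp only: N of_real_eq_0_iff)
    then have "v $ i = 0" if "i < n" for i using that by (simp add: sum_nonneg_eq_0_iff)
    then show False using v(1,2) by (auto intro!: eq_vecI)
  qed
  then have "k = T / N" using TN by simp
  moreover have "T \<in> \<real>" using T by (simp add: Reals_cnj_iff)
  moreover have "N \<in> \<real>" by (simp only: N Reals_of_real)
  ultimately show ?thesis by simp
qed

text \<open>The complex factorisation has only real roots and descends because the embedding of real
  polynomials is injective.\<close>

lemma symmetric_char_poly_splits:
  assumes A: "symmetric_mat n A"
  obtains es where "char_poly A = (\<Prod>e\<leftarrow>es. [:- e, 1:])"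
proof -
  interpret of_real_p: map_poly_inj_comm_ring_hom complex_of_real ..
  have carr: "A \<in> carrier_mat n n" by (rule symmetric_mat_carrier[OF A])
  let ?A = "map_mat complex_of_real A"
  have carr': "?A \<in> carrier_mat n n" using carr by simp
  obtain as where as: "char_poly ?A = (\<Prod>a\<leftarrow>as. [:- a, 1:])"
    using char_poly_factorized[OF carr'] by blast
  have real: "a \<in> \<real>" if "a \<in> set as" for a
  proof -
    have "poly (char_poly ?A) a = 0" using that unfolding as poly_prod_list
      by (auto simp: prod_list_zero_iff image_iff intro!: bexI[of _ a])
    then have "eigenvalue ?A a" using eigenvalue_root_char_poly[OF carr'] by simp
    then show ?thesis by (rule symmetric_eigenvalue_real[OF A])
  qed
  define es where "es = map Re as"
  have as': "as = map complex_of_real es"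
    unfolding es_def map_map by (rule map_idI[symmetric]) (use real in \<open>auto simp: of_real_Re\<close>)
  have "map_poly complex_of_real (char_poly A) = (\<Prod>a\<leftarrow>as. [:- a, 1:])"
    unfolding of_real_hom.char_poly_hom[OF carr, symmetric] by (rule as)
  also have "\<dots> = map_poly complex_of_real (\<Prod>e\<leftarrow>es. [:- e, 1:])"
    unfolding as' of_real_p.hom_prod_list by (simp add: o_def)
  finally have "char_poly A = (\<Prod>e\<leftarrow>es. [:- e, 1:])" by (simp only: of_real_p.eq_iff)
  then show thesis by (rule that)
qed

section \<open>Spectral mapping for polynomials in a matrix\<close>

lemma upper_triangular_pow:
  fixes T :: "real mat"
  assumes T: "T \<in> carrier_mat n n" and ut: "upper_triangular T"
  shows "(\<forall>i<n. \<forall>j<i. (T ^\<^sub>m k) $$ (i, j) = 0) \<and> (\<forall>i<n. (T ^\<^sub>m k) $$ (i, i) = T $$ (i, i) ^ k)"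
proof (induction k)
  case 0
  then show ?case using T by auto
next
  case (Suc k)
  have zero: "T $$ (i, j) = 0" if "j < i" "i < n" for i j using ut that T by auto
  have entry: "(T ^\<^sub>m Suc k) $$ (i, j) = (\<Sum>l<n. (T ^\<^sub>m k) $$ (i, l) * T $$ (l, j))"
    if "i < n" "j < n" for i j
    using mat_mult_index[OF pow_carrier_mat[OF T] T that] by simp
  have "(T ^\<^sub>m Suc k) $$ (i, j) = 0" if "i < n" "j < i" for i j
    unfolding entry[OF that(1) less_trans[OF that(2,1)]]
  proof (intro sum.neutral ballI)
    fix l assume l: "l \<in> {..<n}"
    show "(T ^\<^sub>m k) $$ (i, l) * T $$ (l, j) = 0"
      using Suc zero[of j l] that l by (cases "l < i") auto
  qed
  moreover have "(T ^\<^sub>m Suc k) $$ (i, i) = T $$ (i, i) ^ Suc k" if i: "i < n" for i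
  proof -
    have "(T ^\<^sub>m Suc k) $$ (i, i) = (\<Sum>l<n. if l = i then (T ^\<^sub>m k) $$ (i, i) * T $$ (i, i) else 0)"
      unfolding entry[OF i i]
    proof (intro sum.cong refl)
      fix l assume l: "l \<in> {..<n}"
      show "(T ^\<^sub>m k) $$ (i, l) * T $$ (l, i) = (if l = i then (T ^\<^sub>m k) $$ (i, i) * T $$ (i, i) else 0)"
        using Suc zero[of i l] i l by (cases l i rule: linorder_cases) auto
    qed
    also have "\<dots> = T $$ (i, i) ^ Suc k" using i Suc by simp
    finally show ?thesis .
  qed
  ultimately show ?case by blast
qed

lemma add_poly_mat_carrier [simp]: "add_poly_mat n d f A \<in> carrier_mat n n"
  by (simp add: add_poly_mat_def)

lemma add_poly_mat_0:
  "A \<in> carrier_mat n n \<Longrightarrow> add_poly_mat n 0 f A = A"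
  by (auto simp: add_poly_mat_def intro!: eq_matI)

lemma add_poly_mat_Suc:
  assumes A: "A \<in> carrier_mat n n"
  shows "add_poly_mat n (Suc d) f A = add_poly_mat n d f A + f d \<cdot>\<^sub>m (A ^\<^sub>m d)"
proof -
  define C where "C = A ^\<^sub>m d"
  have "C \<in> carrier_mat n n" unfolding C_def by (rule pow_carrier_mat[OF A])
  then show ?thesis
    unfolding C_def[symmetric] by (intro eq_matI) (auto simp: add_poly_mat_def C_def[symmetric])
qed

lemma add_poly_mat_similar:
  assumes A: "A \<in> carrier_mat n n" and wit: "similar_mat_wit A T P Q"
  shows "similar_mat_wit (add_poly_mat n d f A) (add_poly_mat n d f T) P Q"
proof -
  note w = similar_mat_witD2[OF A wit]
  have "add_poly_mat n d f A = P * add_poly_mat n d f T * Q"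
  proof (induction d)
    case 0
    then show ?case using w by (simp add: add_poly_mat_0)
  next
    case (Suc d)
    let ?X = "add_poly_mat n d f T" and ?Y = "f d \<cdot>\<^sub>m (T ^\<^sub>m d)"
    have X: "?X \<in> carrier_mat n n" and Y: "?Y \<in> carrier_mat n n" and Td: "T ^\<^sub>m d \<in> carrier_mat n n"
      using w(5) by auto
    have "P * (?X + ?Y) * Q = P * ?X * Q + P * ?Y * Q"
      using mult_add_distrib_mat[OF w(6) X Y]
        add_mult_distrib_mat[OF mult_carrier_mat[OF w(6) X] mult_carrier_mat[OF w(6) Y] w(7)] by simp
    also have "P * ?Y * Q = f d \<cdot>\<^sub>m (A ^\<^sub>m d)"
      using mult_smult_distrib[OF w(6) Td, of "f d"]
        mult_smult_assoc_mat[OF mult_carrier_mat[OF w(6) Td] w(7), of "f d"]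
        similar_mat_wit_pow_id[OF wit, of d] by simp
    finally show ?case using Suc w(4,5) by (simp add: add_poly_mat_Suc)
  qed
  from similar_mat_witI[OF w(1,2) this _ _ w(6,7)] show ?thesis by simp
qed

text \<open>Spectral mapping with multiplicities: a Schur form \<open>T\<close> of \<open>A\<close>
  has diagonal \<open>es\<close>, and \<open>T + f(T)\<close> is again upper triangular, with each
  diagonal entry shifted by the value of \<open>f\<close> there.\<close>

lemma char_poly_add_poly_mat:
  assumes A: "A \<in> carrier_mat n n" and es: "char_poly A = (\<Prod>e\<leftarrow>es. [:- e, 1:])"
  shows "char_poly (add_poly_mat n d f A)
    = (\<Prod>e\<leftarrow>map (\<lambda>x. x + (\<Sum>k<d. f k * x ^ k)) es. [:- e, 1:])"
proof -
  obtain T P Q where "schur_decomposition A es = (T, P, Q)" by (cases "schur_decomposition A es")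
  from schur_decomposition[OF A es this]
  have wit: "similar_mat_wit A T P Q" and ut: "upper_triangular T" and diag: "diag_mat T = es" by auto
  have T: "T \<in> carrier_mat n n" using similar_mat_witD2[OF A wit] by simp
  let ?X = "add_poly_mat n d f T"
  have X: "?X \<in> carrier_mat n n" by simp
  note pow = upper_triangular_pow[OF T ut]
  have utX: "upper_triangular ?X"
  proof (rule upper_triangularI)
    fix i j assume "j < i" "i < dim_row ?X"
    then show "?X $$ (i, j) = 0"
      using pow ut T by (auto simp: add_poly_mat_def intro!: sum.neutral)
  qed
  have "diag_mat ?X = map (\<lambda>x. x + (\<Sum>k<d. f k * x ^ k)) (diag_mat T)"
    unfolding diag_mat_def using T pow by (simp add: add_poly_mat_def)
  then have "char_poly ?X = (\<Prod>e\<leftarrow>map (\<lambda>x. x + (\<Sum>k<d. f k * x ^ k)) es. [:- e, 1:])"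
    unfolding char_poly_upper_triangular[OF X utX] diag by simp
  moreover have "char_poly (add_poly_mat n d f A) = char_poly ?X"
    using add_poly_mat_similar[OF A wit] by (intro char_poly_similar) (auto simp: similar_mat_def)
  ultimately show ?thesis by simp
qed

section \<open>Spectra and multiplicity lists read off from linear factors\<close>

lemma spec_mset_factored:
  fixes A :: "real mat"
  assumes "char_poly A = (\<Prod>e\<leftarrow>es. [:- e, 1:])"
  shows "spec_mset A = mset es"
proof -
  have "proots (\<Prod>e\<leftarrow>es. [:- e, 1:]) = mset es"
  proof (induction es)
    case (Cons e es)
    have "(\<Prod>e\<leftarrow>es. [:- e, 1:]) \<noteq> 0" by (auto simp: prod_list_zero_iff)
    then show ?case using Cons by (simp add: proots_mult del: mult_pCons_left)
  qed simp
  then show ?thesis by (simp add: spec_mset_def assms)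
qed

lemma eigenvalues_factored:
  fixes A :: "real mat"
  assumes "A \<in> carrier_mat n n" and "char_poly A = (\<Prod>e\<leftarrow>es. [:- e, 1:])"
  shows "{x. eigenvalue A x} = set es"
  unfolding eigenvalue_root_char_poly[OF assms(1)] assms(2) poly_prod_list
  by (auto simp: prod_list_zero_iff)

lemma ordered_multiplicity_list_factored:
  fixes A :: "real mat"
  assumes "A \<in> carrier_mat n n" and "char_poly A = (\<Prod>e\<leftarrow>es. [:- e, 1:])"
  shows "ordered_multiplicity_list A = map (count (mset es)) (sorted_list_of_set (set es))"
  unfolding ordered_multiplicity_list_def eigenvalues_factored[OF assms] spec_mset_factored[OF assms(2)] ..

lemma sorted_list_of_set_image_strict_mono_on:
  fixes g :: "real \<Rightarrow> real"
  assumes "finite S" and g: "\<And>x y. x \<in> S \<Longrightarrow> y \<in> S \<Longrightarrow> x < y \<Longrightarrow> g x < g y"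
  shows "sorted_list_of_set (g ` S) = map g (sorted_list_of_set S)"
proof -
  let ?xs = "sorted_list_of_set S"
  have S: "set ?xs = S" using assms(1) by simp
  have "sorted_wrt (<) (map g ?xs)"
    unfolding sorted_wrt_map
    by (rule sorted_wrt_mono_rel[OF _ strict_sorted_list_of_set]) (use g S in auto)
  then have "sorted (map g ?xs)" "distinct (map g ?xs)"
    by (simp_all add: strict_sorted_iff)
  from sorted_list_of_set.idem_if_sorted_distinct[OF this] show ?thesis using S by simp
qed

text \<open>Injectivity of \<open>g\<close> on the eigenvalues keeps their multiplicities,
  monotonicity keeps the order in which these are listed.\<close>

lemma multiplicities_strict_mono_on:
  fixes g :: "real \<Rightarrow> real"
  assumes g: "\<And>x y. x \<in> set es \<Longrightarrow> y \<in> set es \<Longrightarrow> x < y \<Longrightarrow> g x < g y"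
  shows "map (count (mset (map g es))) (sorted_list_of_set (set (map g es)))
    = map (count (mset es)) (sorted_list_of_set (set es))"
proof -
  have inj: "inj_on g (set es)"
    by (rule linorder_inj_onI) (use g in \<open>auto simp: less_imp_neq\<close>)
  have "count (image_mset g (mset es)) (g x) = count (mset es) x" if "x \<in> set es" for x
  proof -
    have "set es \<inter> {y. g y = g x} = {x}" using that inj by (auto dest: inj_onD)
    then show ?thesis by (simp add: count_image_mset vimage_def Int_commute)
  qed
  then show ?thesis
    using sorted_list_of_set_image_strict_mono_on[of "set es" g] g by simp
qed

lemma multiplicities_append_ones:
  fixes es ls :: "real list"
  assumes "\<And>x y. x \<in> set es \<Longrightarrow> y \<in> set ls \<Longrightarrow> x < y" and ls: "sorted_wrt (<) ls"
  shows "map (count (mset (es @ ls))) (sorted_list_of_set (set (es @ ls)))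
    = map (count (mset es)) (sorted_list_of_set (set es)) @ replicate (length ls) 1"
proof -
  let ?xs = "sorted_list_of_set (set es)"
  have "sorted_wrt (<) (?xs @ ls)"
    unfolding sorted_wrt_append using assms strict_sorted_list_of_set[of "set es"] by simp
  then have s: "sorted (?xs @ ls)" "distinct (?xs @ ls)" by (simp_all only: strict_sorted_iff)
  have "sorted_list_of_set (set (es @ ls)) = ?xs @ ls"
    using sorted_list_of_set.idem_if_sorted_distinct[OF s] by simp
  moreover have "map (count (mset (es @ ls))) ?xs = map (count (mset es)) ?xs"
  proof (rule map_cong[OF refl])
    fix x assume "x \<in> set ?xs"
    then have "x \<notin> set ls" using assms(1)[of x x] by auto
    then show "count (mset (es @ ls)) x = count (mset es) x" by (simp add: count_eq_zero_iff)
  qed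
  moreover have "map (count (mset (es @ ls))) ls = replicate (length ls) 1"
  proof (subst map_replicate_const[symmetric], rule map_cong[OF refl])
    fix x assume x: "x \<in> set ls"
    then have "x \<notin> set es" using assms(1)[of x x] by auto
    moreover have "count (mset ls) x = 1"
      using x ls unfolding strict_sorted_iff distinct_count_atmost_1 by simp
    ultimately show "count (mset (es @ ls)) x = 1" by (simp add: count_eq_zero_iff)
  qed
  ultimately show ?thesis by simp
qed

section \<open>Direct sums with diagonal matrices\<close>

definition direct_sum_diag :: "nat \<Rightarrow> real mat \<Rightarrow> real list \<Rightarrow> real mat" where
  "direct_sum_diag n A ls = four_block_mat A (0\<^sub>m n (length ls)) (0\<^sub>m (length ls) n)
     (mat (length ls) (length ls) (\<lambda>(i, j). if i = j then ls ! i else 0))"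

lemma direct_sum_diag_carrier:
  "A \<in> carrier_mat n n \<Longrightarrow> direct_sum_diag n A ls \<in> carrier_mat (n + length ls) (n + length ls)"
  unfolding direct_sum_diag_def by (rule four_block_carrier_mat) auto

lemma direct_sum_diag_index:
  assumes "A \<in> carrier_mat n n" "i < n + length ls" "j < n + length ls"
  shows "direct_sum_diag n A ls $$ (i, j) = (if i < n \<and> j < n then A $$ (i, j)
    else if i = j then ls ! (i - n) else 0)"
  using assms unfolding direct_sum_diag_def by auto

lemma direct_sum_diag_symmetric:
  assumes "symmetric_mat n A"
  shows "symmetric_mat (n + length ls) (direct_sum_diag n A ls)"
  using symmetric_mat_carrier[OF assms]
  by (intro symmetric_matI) (auto simp: direct_sum_diag_index direct_sum_diag_carrier symmetric_matD[OF assms])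

text \<open>The lower right block is left out, as it is only paired with entries of \<open>X\<close>
  already known to vanish.\<close>

lemma direct_sum_diag_pow_index:
  assumes A: "A \<in> carrier_mat n n" and "i < n + length ls" "j < n + length ls" "i < n \<or> j < n"
  shows "(direct_sum_diag n A ls ^\<^sub>m k) $$ (i, j) = (if i < n \<and> j < n then (A ^\<^sub>m k) $$ (i, j) else 0)"
proof -
  let ?D = "mat (length ls) (length ls) (\<lambda>(i, j). if i = j then ls ! i else 0) :: real mat"
  define Ak where "Ak = A ^\<^sub>m k"
  define Dk where "Dk = ?D ^\<^sub>m k"
  have "Ak \<in> carrier_mat n n" unfolding Ak_def by (rule pow_carrier_mat[OF A])
  moreover have "Dk \<in> carrier_mat (length ls) (length ls)" unfolding Dk_def by (rule pow_carrier_mat) simp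
  moreover have "direct_sum_diag n A ls ^\<^sub>m k
      = four_block_mat Ak (0\<^sub>m n (length ls)) (0\<^sub>m (length ls) n) Dk"
    unfolding direct_sum_diag_def Ak_def Dk_def by (rule pow_four_block_mat[OF A]) simp
  ultimately show ?thesis using assms(2-4) unfolding Ak_def[symmetric] by auto
qed

lemma char_poly_direct_sum_diag:
  assumes A: "A \<in> carrier_mat n n" and es: "char_poly A = (\<Prod>e\<leftarrow>es. [:- e, 1:])"
  shows "char_poly (direct_sum_diag n A ls) = (\<Prod>e\<leftarrow>es @ ls. [:- e, 1:])"
proof -
  let ?D = "mat (length ls) (length ls) (\<lambda>(i, j). if i = j then ls ! i else 0) :: real mat"
  have D: "?D \<in> carrier_mat (length ls) (length ls)" by simp
  have "char_poly ?D = (\<Prod>e\<leftarrow>diag_mat ?D. [:- e, 1:])"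
    by (rule char_poly_upper_triangular[OF D]) auto
  moreover have "diag_mat ?D = ls"
    by (rule nth_equalityI) (auto simp: diag_mat_def)
  ultimately have cD: "char_poly ?D = (\<Prod>e\<leftarrow>ls. [:- e, 1:])" by simp
  have "char_poly (direct_sum_diag n A ls) = char_poly A * char_poly ?D"
    by (rule char_poly_0_block[OF direct_sum_diag_def _ _ A _ D]) (use es cD in \<open>auto intro: exI[of _ es] exI[of _ ls]\<close>)
  then show ?thesis by (simp add: es cD)
qed

text \<open>
  A matrix commuting with \<open>A \<oplus> D\<close> has zero off-diagonal blocks, as \<open>A\<close> and \<open>D\<close> share no
  eigenvalue, and its last block is diagonal, as \<open>D\<close> has distinct entries.
\<close>

lemma strong_direct_sum_diag:
  assumes A: "symmetric_mat n A" and st: "strong n d A" and "d \<le> d'"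
    and ls: "distinct ls" and disj: "\<And>l. l \<in> set ls \<Longrightarrow> \<not> eigenvalue A l"
  shows "strong (n + length ls) d' (direct_sum_diag n A ls)"
  unfolding strong_def
proof (intro allI impI)
  let ?m = "n + length ls"
  let ?M = "direct_sum_diag n A ls"
  fix X
  assume X: "symmetric_mat ?m X"
    and supp: "\<forall>i<?m. \<forall>j<?m. ?M $$ (i, j) \<noteq> 0 \<or> i = j \<longrightarrow> X $$ (i, j) = 0"
    and comm: "?M * X = X * ?M" and pow: "\<forall>k<d'. frob ?m (?M ^\<^sub>m k) X = 0"
  have Ac: "A \<in> carrier_mat n n" and Xc: "X \<in> carrier_mat ?m ?m"
    using A X by (auto simp: symmetric_mat_def)
  note Mc = direct_sum_diag_carrier[OF Ac, of ls]
  note idx = direct_sum_diag_index[OF Ac, of _ ls]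
  have entry: "(\<Sum>k<?m. ?M $$ (i, k) * X $$ (k, j)) = (\<Sum>k<?m. X $$ (i, k) * ?M $$ (k, j))"
    if "i < ?m" "j < ?m" for i j
    using mat_mult_index[OF Mc Xc that] mat_mult_index[OF Xc Mc that] comm by simp
  have split: "(\<Sum>k<?m. g k) = (\<Sum>k<n. g k) + (\<Sum>k\<in>{n..<?m}. g k)" for g :: "nat \<Rightarrow> real"
    using sum.atLeastLessThan_concat[of 0 n ?m g] by (simp add: lessThan_atLeast0)
  have top: "(\<Sum>k<?m. ?M $$ (i, k) * g k) = (\<Sum>k<n. A $$ (i, k) * g k)" if "i < n" for i and g :: "nat \<Rightarrow> real"
  proof -
    have "(\<Sum>k<n. ?M $$ (i, k) * g k) = (\<Sum>k<n. A $$ (i, k) * g k)"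
      using that by (intro sum.cong) (auto simp: idx)
    moreover have "(\<Sum>k\<in>{n..<?m}. ?M $$ (i, k) * g k) = 0"
      using that by (intro sum.neutral) (auto simp: idx)
    ultimately show ?thesis unfolding split by simp
  qed
  have bot: "(\<Sum>k<?m. ?M $$ (i, k) * g k) = ls ! (i - n) * g i"
    if "n \<le> i" "i < ?m" for i and g :: "nat \<Rightarrow> real"
  proof -
    have "(\<Sum>k<?m. ?M $$ (i, k) * g k) = (\<Sum>k<?m. if k = i then ls ! (i - n) * g i else 0)"
      using that by (intro sum.cong) (auto simp: idx)
    then show ?thesis using that by simp
  qed
  have right: "(\<Sum>k<?m. g k * ?M $$ (k, j)) = (\<Sum>k<?m. ?M $$ (j, k) * g k)"
    if "j < ?m" for j and g :: "nat \<Rightarrow> real"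
    using symmetric_matD[OF direct_sum_diag_symmetric[OF A] that]
    by (intro sum.cong) (auto simp: mult.commute)
  have X22: "X $$ (i, j) = 0" if i: "n \<le> i" "i < ?m" and j: "n \<le> j" "j < ?m" for i j
  proof (cases "i = j")
    case True
    then show ?thesis using supp i by blast
  next
    case False
    have "ls ! (i - n) * X $$ (i, j) = ls ! (j - n) * X $$ (i, j)"
      using entry[OF i(2) j(2)] unfolding right[OF j(2)] bot[OF i] bot[OF j] .
    moreover have "ls ! (i - n) \<noteq> ls ! (j - n)"
      using ls i j False by (simp add: nth_eq_iff_index_eq)
    ultimately show ?thesis by simp
  qed
  have X12: "X $$ (i, j) = 0" if i: "i < n" and j: "n \<le> j" "j < ?m" for i j
  proof -
    \<comment> \<open>The upper part of column \<open>j\<close> of \<open>X\<close>. The commutation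
      relation in this column makes it an eigenvector of \<open>A\<close> for \<open>?l\<close>,
      unless it is zero.\<close>
    define v where "v = vec n (\<lambda>k. X $$ (k, j))"
    let ?l = "ls ! (j - n)"
    have "A *\<^sub>v v = ?l \<cdot>\<^sub>v v"
    proof (rule eq_vecI)
      fix a assume "a < dim_vec (?l \<cdot>\<^sub>v v)"
      then have a: "a < n" by (simp add: v_def)
      have "(A *\<^sub>v v) $ a = (\<Sum>k<n. A $$ (a, k) * X $$ (k, j))"
        using Ac a by (auto simp: v_def scalar_prod_def lessThan_atLeast0 intro!: sum.cong)
      also have "\<dots> = ?l * X $$ (a, j)"
        using entry[of a j] a j unfolding right[OF j(2)] top[OF a] bot[OF j] by simp
      finally show "(A *\<^sub>v v) $ a = (?l \<cdot>\<^sub>v v) $ a" using a by (simp add: v_def)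
    qed (use Ac in \<open>simp add: v_def\<close>)
    moreover have "\<not> eigenvalue A ?l" using j by (intro disj nth_mem) auto
    moreover have "v \<in> carrier_vec n" by (simp add: v_def)
    ultimately have "v = 0\<^sub>v n" using Ac unfolding eigenvalue_def eigenvector_def by auto
    then have "v $ i = 0" using i by simp
    then show ?thesis using i by (simp add: v_def)
  qed
  have X21: "X $$ (i, j) = 0" if "n \<le> i" "i < ?m" "j < n" for i j
    using X12[OF that(3,1,2)] symmetric_matD[OF X, of i j] that by simp
  define Y where "Y = mat n n (\<lambda>ij. X $$ ij)"
  have Yc: "Y \<in> carrier_mat n n" by (simp add: Y_def)
  have "Y = 0\<^sub>m n n"
  proof (rule st[unfolded strong_def, rule_format])
    show "symmetric_mat n Y"
      by (rule symmetric_matI[OF Yc]) (use symmetric_matD[OF X] in \<open>simp add: Y_def\<close>)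
    show "Y $$ (i, j) = 0" if "i < n" "j < n" "A $$ (i, j) \<noteq> 0 \<or> i = j" for i j
      using supp that by (simp add: Y_def idx)
    show "A * Y = Y * A"
    proof (rule eq_matI)
      fix i j assume "i < dim_row (Y * A)" "j < dim_col (Y * A)"
      then have ij: "i < n" "j < n" using Ac by (auto simp: Y_def)
      have "(A * Y) $$ (i, j) = (\<Sum>k<n. A $$ (i, k) * X $$ (k, j))"
        unfolding mat_mult_index[OF Ac Yc ij] by (intro sum.cong) (use ij in \<open>auto simp: Y_def\<close>)
      also have "\<dots> = (\<Sum>k<n. A $$ (j, k) * X $$ (i, k))"
        using entry[of i j] ij right[of j "\<lambda>k. X $$ (i, k)"] unfolding top[OF ij(1)]
        by (simp add: top)
      also have "\<dots> = (Y * A) $$ (i, j)"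
        unfolding mat_mult_index[OF Yc Ac ij]
        by (intro sum.cong) (use ij symmetric_matD[OF A] in \<open>auto simp: Y_def\<close>)
      finally show "(A * Y) $$ (i, j) = (Y * A) $$ (i, j)" .
    qed (use Ac Yc in auto)
    show "frob n (A ^\<^sub>m k) Y = 0" if k: "k < d" for k
    proof -
      have "(\<Sum>j<?m. (?M ^\<^sub>m k) $$ (i, j) * X $$ (i, j)) = (\<Sum>j<n. (A ^\<^sub>m k) $$ (i, j) * Y $$ (i, j))"
        if i: "i < n" for i
      proof -
        have "(\<Sum>j\<in>{n..<?m}. (?M ^\<^sub>m k) $$ (i, j) * X $$ (i, j)) = 0"
          using i X12 by (intro sum.neutral) auto
        moreover have "(\<Sum>j<n. (?M ^\<^sub>m k) $$ (i, j) * X $$ (i, j))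
            = (\<Sum>j<n. (A ^\<^sub>m k) $$ (i, j) * Y $$ (i, j))"
          using i by (intro sum.cong) (auto simp: direct_sum_diag_pow_index[OF Ac] Y_def)
        ultimately show ?thesis unfolding split by simp
      qed
      moreover have "(\<Sum>j<?m. (?M ^\<^sub>m k) $$ (i, j) * X $$ (i, j)) = 0" if "n \<le> i" "i < ?m" for i
        using that X21 X22 by (intro sum.neutral) (metis lessThan_iff mult_zero_right not_less)
      \<comment> \<open>Outside the first block \<open>X\<close> vanishes, so the power conditions
        for the direct sum reduce to those for \<open>A\<close>; they are available since
        \<open>k < d \<le> d'\<close>.\<close>
      ultimately have "frob ?m (?M ^\<^sub>m k) X = frob n (A ^\<^sub>m k) Y"
        unfolding frob_def by (subst split) (simp add: sum.neutral)
      then show ?thesis using pow k \<open>d \<le> d'\<close> by simp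
    qed
  qed
  then have X11: "X $$ (i, j) = 0" if "i < n" "j < n" for i j
    using that by (metis Y_def index_mat(1) index_zero_mat(1))
  show "X = 0\<^sub>m ?m ?m"
  proof (rule eq_matI)
    fix i j assume "i < dim_row (0\<^sub>m ?m ?m :: real mat)" "j < dim_col (0\<^sub>m ?m ?m :: real mat)"
    then have ij: "i < ?m" "j < ?m" by simp_all
    then have "X $$ (i, j) = 0"
      using X11[of i j] X12[of i j] X21[of i j] X22[of i j] by (cases "i < n"; cases "j < n") simp_all
    then show "X $$ (i, j) = 0\<^sub>m ?m ?m $$ (i, j)" using ij by simp
  qed (use Xc in auto)
qed

section \<open>Realisation on the larger graph\<close>

lemma graph_mats_iff:
  assumes "graph_on n G"
  shows "A \<in> graph_mats G \<longleftrightarrow> symmetric_mat n A \<and>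
    (\<forall>i<n. \<forall>j<n. i \<noteq> j \<longrightarrow> (A $$ (i, j) \<noteq> 0 \<longleftrightarrow> (i, j) \<in> parcs G))"
  using assms unfolding graph_on_def graph_mats_def by auto

lemma graph_on_sym:
  assumes "graph_on n G" "(i, j) \<in> parcs G"
  shows "(j, i) \<in> parcs G"
proof -
  interpret pair_graph G using assms(1) by (simp add: graph_on_def)
  show ?thesis using pair_sym_arcs assms(2) unfolding symmetric_def by (simp add: symD)
qed

lemma subgraph_parcs:
  "subgraph (with_proj G) (with_proj H) \<Longrightarrow> (i, j) \<in> parcs G \<Longrightarrow> (i, j) \<in> parcs H"
  unfolding subgraph_def by auto

text \<open>Covers both properties: the SSP with \<open>d = d' = 0\<close>, the SMP with
  \<open>d = n\<close> and \<open>d' = m\<close>, as the number of powers in the SMP is the size of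
  the matrix. The off-diagonal support of the direct sum lies in \<open>G\<close>, hence in
  \<open>Ghat\<close>, so \<open>strong_supergraph\<close> applies on the common vertex set.\<close>

lemma supergraph_realisation:
  fixes n m :: nat and G Ghat :: "nat pair_pre_digraph" and A :: "real mat" and ls :: "real list"
  assumes G: "graph_on n G" and Gh: "graph_on m Ghat" and "n \<le> m"
    and sub: "subgraph (with_proj G) (with_proj Ghat)" and AG: "A \<in> graph_mats G"
    and st: "strong n d A" and d: "d \<le> d'"
    and es: "char_poly A = (\<Prod>e\<leftarrow>es. [:- e, 1:])"
    and ls: "length ls = m - n" "distinct ls" "set es \<inter> set ls = {}"
  obtains B f where "B \<in> graph_mats Ghat" "strong m d' B"
    "char_poly B = (\<Prod>e\<leftarrow>map (\<lambda>x. x + (\<Sum>k<d'. f k * x ^ k)) (es @ ls). [:- e, 1:])"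
    "\<forall>x\<in>set (es @ ls). \<forall>y\<in>set (es @ ls). x < y \<longrightarrow>
       x + (\<Sum>k<d'. f k * x ^ k) < y + (\<Sum>k<d'. f k * y ^ k)"
proof -
  have A: "symmetric_mat n A"
    and pat: "\<And>i j. i < n \<Longrightarrow> j < n \<Longrightarrow> i \<noteq> j \<Longrightarrow> A $$ (i, j) \<noteq> 0 \<longleftrightarrow> (i, j) \<in> parcs G"
    using AG unfolding graph_mats_iff[OF G] by auto
  have Ac: "A \<in> carrier_mat n n" by (rule symmetric_mat_carrier[OF A])
  have m: "n + length ls = m" using ls(1) \<open>n \<le> m\<close> by simp
  define M where "M = direct_sum_diag n A ls"
  have M: "symmetric_mat m M" using direct_sum_diag_symmetric[OF A, of ls] by (simp add: M_def m)
  have disj: "\<not> eigenvalue A l" if "l \<in> set ls" for l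
    using eigenvalues_factored[OF Ac es] ls(3) that by auto
  have Mst: "strong m d' M"
    using strong_direct_sum_diag[OF A st d ls(2) disj] by (simp add: M_def m)
  have cpM: "char_poly M = (\<Prod>e\<leftarrow>es @ ls. [:- e, 1:])"
    unfolding M_def by (rule char_poly_direct_sum_diag[OF Ac es])
  have Msub: "(i, j) \<in> parcs Ghat" if "i < m" "j < m" "i \<noteq> j" "M $$ (i, j) \<noteq> 0" for i j
  proof -
    have "i < n" "j < n" "A $$ (i, j) \<noteq> 0"
      using that direct_sum_diag_index[OF Ac, of i ls j] by (auto simp: M_def m split: if_splits)
    then show ?thesis using pat subgraph_parcs[OF sub] that by blast
  qed
  obtain B f where B: "symmetric_mat m B" "strong m d' B"
    "\<forall>i<m. \<forall>j<m. i \<noteq> j \<longrightarrow> (B $$ (i, j) \<noteq> 0 \<longleftrightarrow> (i, j) \<in> parcs Ghat)"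
    "char_poly B = char_poly (add_poly_mat m d' f M)"
    "\<forall>x\<in>set (es @ ls). \<forall>y\<in>set (es @ ls). x < y \<longrightarrow>
       x + (\<Sum>k<d'. f k * x ^ k) < y + (\<Sum>k<d'. f k * y ^ k)"
    using strong_supergraph[of m M d' "parcs Ghat" "set (es @ ls)", OF M Mst graph_on_sym[OF Gh] Msub finite_set]
    by blast
  show thesis
  proof (rule that)
    show "B \<in> graph_mats Ghat" using B(1,3) unfolding graph_mats_iff[OF Gh] by blast
    show "char_poly B = (\<Prod>e\<leftarrow>map (\<lambda>x. x + (\<Sum>k<d'. f k * x ^ k)) (es @ ls). [:- e, 1:])"
      unfolding B(4) by (rule char_poly_add_poly_mat[OF symmetric_mat_carrier[OF M] cpM])
  qed (use B(2,5) in blast)+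
qed

lemma append_in_shuffles: "xs @ ys \<in> shuffles xs ys"
  by (induction xs) (auto intro: Cons_in_shuffles_leftI)

theorem theorem3p10:
  fixes n m :: nat and G Ghat :: "nat pair_pre_digraph" and A :: "real mat"
  assumes "graph_on n G" and "graph_on m Ghat" and "n \<le> m"
    and "subgraph (with_proj G) (with_proj Ghat)"
    and "A \<in> graph_mats G"
  shows
    "(SSP A \<longrightarrow> (\<exists>B \<in> graph_mats Ghat. SSP B \<and> spec_mset A \<subseteq># spec_mset B))
     \<and> (SMP A \<longrightarrow> (\<exists>B \<in> graph_mats Ghat. SMP B \<and>
          augmented_with_ones (ordered_multiplicity_list A) (m - n) (ordered_multiplicity_list B)))
     \<and> (SSP A \<or> SMP A \<longrightarrow> graph_q Ghat \<le> m - n + num_distinct_eigenvalues A)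
     \<and> (SSP A \<longrightarrow> (\<forall>\<Lambda> :: real set. finite \<Lambda> \<and> card \<Lambda> = m - n \<and> set_mset (spec_mset A) \<inter> \<Lambda> = {}
          \<longrightarrow> (\<exists>B \<in> graph_mats Ghat. SSP B \<and> spec_mset B = spec_mset A + mset_set \<Lambda>)))"
proof -
  have A: "symmetric_mat n A" using assms(5) unfolding graph_mats_iff[OF assms(1)] by blast
  have Ac: "A \<in> carrier_mat n n" by (rule symmetric_mat_carrier[OF A])
  have carr: "B \<in> carrier_mat m m" if "B \<in> graph_mats Ghat" for B
    using that symmetric_mat_carrier unfolding graph_mats_iff[OF assms(2)] by blast
  obtain es where es: "char_poly A = (\<Prod>e\<leftarrow>es. [:- e, 1:])"
    by (rule symmetric_char_poly_splits[OF A])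
  note realise = supergraph_realisation[OF assms(1-5) _ _ es]
  have specA: "spec_mset A = mset es" by (rule spec_mset_factored[OF es])

  have ssp: "\<exists>B \<in> graph_mats Ghat. SSP B \<and> spec_mset B = spec_mset A + mset_set \<Lambda>"
    if "SSP A" "finite \<Lambda>" "card \<Lambda> = m - n" "set_mset (spec_mset A) \<inter> \<Lambda> = {}" for \<Lambda>
  proof -
    obtain ls where ls: "set ls = \<Lambda>" "distinct ls"
      using finite_distinct_list[OF \<open>finite \<Lambda>\<close>] by blast
    have st: "strong n 0 A" using \<open>SSP A\<close> SSP_iff_strong[OF Ac] by simp
    have len: "length ls = m - n" using ls that(3) distinct_card[OF ls(2)] by simp
    have disj: "set es \<inter> set ls = {}" using ls that(4) specA by simp
    \<comment> \<open>With \<open>d' = 0\<close> the sums are empty: no eigenvalue moves, and the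
      spectrum is exactly \<open>es\<close> together with \<open>\<Lambda>\<close>.\<close>
    obtain B f where B: "B \<in> graph_mats Ghat" "strong m 0 B"
      "char_poly B = (\<Prod>e\<leftarrow>map (\<lambda>x. x + (\<Sum>k<0. f k * x ^ k)) (es @ ls). [:- e, 1:])"
      by (rule realise[OF st order_refl len ls(2) disj])
    have "spec_mset B = mset (es @ ls)" using spec_mset_factored[OF B(3)] by simp
    also have "\<dots> = spec_mset A + mset_set \<Lambda>"
      using ls by (simp add: specA mset_set_set[symmetric])
    finally show ?thesis using B SSP_iff_strong[OF carr[OF B(1)]] by blast
  qed

  have smp: "\<exists>B \<in> graph_mats Ghat. SMP B \<and>
      ordered_multiplicity_list B = ordered_multiplicity_list A @ replicate (m - n) 1"
    if "SMP A"
  proof -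
    \<comment> \<open>The new eigenvalues \<open>c\<close>, \<open>c + 1\<close>, ... lie above all
      of \<open>es\<close>. Their multiplicities then come last, and inserting the ones is an
      append.\<close>
    obtain c where c: "\<And>x. x \<in> set es \<Longrightarrow> x < c"
    proof
      fix x assume "x \<in> set es"
      then have "\<bar>x\<bar> \<le> (\<Sum>x\<in>set es. \<bar>x\<bar>)" by (intro member_le_sum) auto
      then show "x < (\<Sum>x\<in>set es. \<bar>x\<bar>) + 1" by linarith
    qed
    define ls where "ls = map (\<lambda>i. c + real i) [0..<m - n]"
    have len: "length ls = m - n" by (simp add: ls_def)
    have sorted: "sorted_wrt (<) ls"
      unfolding ls_def sorted_wrt_map by (rule sorted_wrt_mono_rel[OF _ sorted_wrt_upt]) simp
    then have dist: "distinct ls" by (simp add: strict_sorted_iff)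
    have above: "x < y" if "x \<in> set es" "y \<in> set ls" for x y
      using c[OF that(1)] that(2) by (auto simp: ls_def)
    have st: "strong n n A" using \<open>SMP A\<close> SMP_iff_strong[OF Ac] by simp
    have disj: "set es \<inter> set ls = {}" using above by force
    obtain B f where B: "B \<in> graph_mats Ghat" "strong m m B"
      "char_poly B = (\<Prod>e\<leftarrow>map (\<lambda>x. x + (\<Sum>k<m. f k * x ^ k)) (es @ ls). [:- e, 1:])"
      "\<forall>x\<in>set (es @ ls). \<forall>y\<in>set (es @ ls). x < y \<longrightarrow>
         x + (\<Sum>k<m. f k * x ^ k) < y + (\<Sum>k<m. f k * y ^ k)"
      by (rule realise[OF st \<open>n \<le> m\<close> len dist disj])
    have "ordered_multiplicity_list B
        = map (count (mset (es @ ls))) (sorted_list_of_set (set (es @ ls)))"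
      unfolding ordered_multiplicity_list_factored[OF carr[OF B(1)] B(3)]
      by (rule multiplicities_strict_mono_on[OF B(4)[rule_format]])
    also have "\<dots> = map (count (mset es)) (sorted_list_of_set (set es)) @ replicate (length ls) 1"
      by (rule multiplicities_append_ones[OF above sorted])
    also have "\<dots> = ordered_multiplicity_list A @ replicate (m - n) 1"
      by (simp only: ordered_multiplicity_list_factored[OF Ac es] len)
    finally show ?thesis using B SMP_iff_strong[OF carr[OF B(1)]] by blast
  qed

  \<comment> \<open>The SMP puts more conditions on \<open>X\<close> and is thus the weaker
    property, so the bound on \<open>q\<close> only has to be derived from it.\<close>
  have ssp_smp: "SMP A" if "SSP A"
    using that unfolding SSP_iff_strong[OF Ac] SMP_iff_strong[OF Ac] strong_def by blast

  have q: "graph_q Ghat \<le> m - n + num_distinct_eigenvalues A" if SMP: "SMP A"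
  proof -
    obtain B where B: "B \<in> graph_mats Ghat"
      "ordered_multiplicity_list B = ordered_multiplicity_list A @ replicate (m - n) 1"
      using smp[OF SMP] by blast
    \<comment> \<open>The list has one entry for each distinct eigenvalue, so \<open>m - n\<close>
      appended ones add \<open>m - n\<close> to their number.\<close>
    have "length (ordered_multiplicity_list C) = num_distinct_eigenvalues C" for C
      by (simp add: ordered_multiplicity_list_def num_distinct_eigenvalues_def)
    then have "num_distinct_eigenvalues B = m - n + num_distinct_eigenvalues A"
      using arg_cong[OF B(2), of length] by simp
    moreover have "graph_q Ghat \<le> num_distinct_eigenvalues B"
      unfolding graph_q_def by (rule Least_le) (use B(1) in blast)
    ultimately show ?thesis by simp
  qed

  have "\<exists>B \<in> graph_mats Ghat. SSP B \<and> spec_mset A \<subseteq># spec_mset B" if "SSP A"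
  proof -
    have "infinite (UNIV - set es :: real set)"
      by (rule Diff_infinite_finite[OF finite_set infinite_UNIV_char_0])
    then obtain \<Lambda> where \<Lambda>: "finite \<Lambda>" "card \<Lambda> = m - n" "\<Lambda> \<subseteq> UNIV - set es"
      using infinite_arbitrarily_large by blast
    then have "set_mset (spec_mset A) \<inter> \<Lambda> = {}" using specA by auto
    from ssp[OF that \<Lambda>(1,2) this] show ?thesis by auto
  qed
  moreover have "\<exists>B \<in> graph_mats Ghat. SMP B \<and>
      augmented_with_ones (ordered_multiplicity_list A) (m - n) (ordered_multiplicity_list B)"
    if "SMP A"
    using smp[OF that] append_in_shuffles unfolding augmented_with_ones_def by metis
  ultimately show ?thesis using ssp q ssp_smp by blast
qed

end
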